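(* Under partial information feedback, when $v_1,\dots,v_T$ are sampled i.i.d. from some distribution $F$ on $[0,\bar v]$, there is a constant $C$ such that with probability at least $1-4/T$, the OGD-CB algorithm $\beta$ guarantees \[\mathrm{OPT}-R^\beta(\bm v,\bm p)\le C\sqrt{T\ln T}.\]
   Context: Model: constants $\bar v>0$, $\rho\in(0,\bar v]$; $T$ rounds; budget $B=\rho T$. Round $t$: value $v_t\in[0,\bar v]$; highest competing bid $p_t$ i.i.d. from an unknown distribution $G$ on $[0,\bar v]$, independent of values. Buyer chooses $x_t\in\{0,1\}$, receives $x_tr_t$ with $r_t=(v_t-p_t)^+$, pays $x_tc_t$ with $c_t=p_t\mathbf 1[v_t\ge p_t]$. Partial information feedback: $p_t$ is observed only when $x_t=1$. Revenue $R^\beta(\bm v,\bm p)=\sum_{t=1}^{T_0}x_tr_t$, $T_0$ the ending time. $\mathrm{OPT}=T\max_{\pi:[0,\bar v]\to[0,1]}\mathbb E_{v\sim F,p\sim G}[\pi(v)(v-p)^+]$ s.t. $\mathbb E_{v\sim F,p\sim G}[\pi(v)p\mathbf 1[v\ge p]]\le\rho$. OGD-CB algorithm: $\mathcal I_1=\emptyset$, $B_1=B$, $\lambda_1=0$. For $t=1,\dots,T$: observe $v_t$. If $t=1$: $x_1=1$, $\lambda_2=\lambda_1$. Otherwise: $\epsilon_t=\sqrt{(\ln 2+2\ln T)/(2|\mathcal I_t|)}$; $\tilde r_t(v)=\frac1{|\mathcal I_t|}\sum_{\tau\in\mathcal I_t}(v-p_\tau)^++\epsilon_tv$; $\tilde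 c_t(v)=\frac1{|\mathcal I_t|}\sum_{\tau\in\mathcal I_t}p_\tau\mathbf 1[v\ge p_\tau]-2\epsilon_tv$; $x_t=\mathbf 1[\tilde r_t(v_t)\ge\lambda_t\tilde c_t(v_t)]$; $\eta_t=1/(\bar v\sqrt t)$; $\lambda_{t+1}=(\lambda_t+\eta_t(x_t\tilde c_t(v_t)-\rho))^+$. If $x_t=1$, observe $p_t$ and set $\mathcal I_{t+1}=\mathcal I_t\cup\{t\}$, else $\mathcal I_{t+1}=\mathcal I_t$. Set $B_{t+1}=B_t-x_tc_t$; if $B_{t+1}<\bar v$, stop; $T_0$ is the stopping round (or $T$). *)

theory Defs
  imports "HOL-Probability.Probability"
begin

definition dist_on :: "real \<Rightarrow> real measure \<Rightarrow> bool" where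
  "dist_on vbar F \<longleftrightarrow> prob_space F \<and> sets F = sets borel \<and>
     (AE x in F. 0 \<le> x \<and> x \<le> vbar)"

definition rew :: "real \<Rightarrow> real \<Rightarrow> real" where
  "rew v p = max (v - p) 0"

definition cost :: "real \<Rightarrow> real \<Rightarrow> real" where
  "cost v p = (if v \<ge> p then p else 0)"

definition OPT :: "real measure \<Rightarrow> real measure \<Rightarrow> real \<Rightarrow> nat \<Rightarrow> real" where
  "OPT F G \<rho> T = real T *
     (SUP \<pi> \<in> {\<pi> \<in> borel_measurable borel. (\<forall>v. 0 \<le> \<pi> v \<and> \<pi> v \<le> 1) \<and>
                (\<integral>vp. \<pi> (fst vp) * cost (fst vp) (snd vp) \<partial>(F \<Otimes>\<^sub>M G)) \<le> \<rho>}.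
        \<integral>vp. \<pi> (fst vp) * rew (fst vp) (snd vp) \<partial>(F \<Otimes>\<^sub>M G))"

text \<open>Confidence radius and the optimistic/pessimistic estimates of OGD-CB
  (used at rounds t >= 2, built only from observed prices p_tau, tau in I).\<close>
definition ogd_eps :: "nat \<Rightarrow> nat set \<Rightarrow> real" where
  "ogd_eps T I = sqrt ((ln 2 + 2 * ln (real T)) / (2 * real (card I)))"

definition ogd_rt :: "nat \<Rightarrow> nat set \<Rightarrow> (nat \<Rightarrow> real) \<Rightarrow> real \<Rightarrow> real" where
  "ogd_rt T I p v = (\<Sum>\<tau>\<in>I. rew v (p \<tau>)) / real (card I) + ogd_eps T I * v"

definition ogd_ct :: "nat \<Rightarrow> nat set \<Rightarrow> (nat \<Rightarrow> real) \<Rightarrow> real \<Rightarrow> real" where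
  "ogd_ct T I p v = (\<Sum>\<tau>\<in>I. cost v (p \<tau>)) / real (card I) - 2 * ogd_eps T I * v"

text \<open>State before round t: (I_t, B_t, lambda_t, still running, accumulated revenue).
  ogd_run ... k is the state after rounds 1..k.\<close>
primrec ogd_run :: "real \<Rightarrow> real \<Rightarrow> nat \<Rightarrow> (nat \<Rightarrow> real) \<Rightarrow> (nat \<Rightarrow> real) \<Rightarrow> nat
    \<Rightarrow> nat set \<times> real \<times> real \<times> bool \<times> real" where
  "ogd_run vbar \<rho> T v p 0 = ({}, \<rho> * real T, 0, True, 0)"
| "ogd_run vbar \<rho> T v p (Suc k) =
     (case ogd_run vbar \<rho> T v p k of (I, B, lam, act, R) \<Rightarrow>
       if \<not> act then (I, B, lam, act, R) else
       (let t = Suc k;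
            x = (t = 1 \<or> ogd_rt T I p (v t) \<ge> lam * ogd_ct T I p (v t));
            lam' = (if t = 1 then lam else
                      max 0 (lam + (1 / (vbar * sqrt (real t))) *
                               ((if x then ogd_ct T I p (v t) else 0) - \<rho>)));
            I' = (if x then insert t I else I);
            B' = B - (if x then cost (v t) (p t) else 0);
            R' = R + (if x then rew (v t) (p t) else 0)
        in (I', B', lam', \<not> (B' < vbar), R')))"

text \<open>Revenue R^beta(v,p) = sum_{t=1}^{T_0} x_t r_t, T_0 the stopping round (or T).\<close>
definition ogd_revenue :: "real \<Rightarrow> real \<Rightarrow> nat \<Rightarrow> (nat \<Rightarrow> real) \<Rightarrow> (nat \<Rightarrow> real) \<Rightarrow> real" where
  "ogd_revenue vbar \<rho> T v p = snd (snd (snd (snd (ogd_run vbar \<rho> T v p T))))"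

end

theory Submission
  imports Defs
begin

text \<open>
  By weak duality \<open>OPT/T \<le> \<phi>(\<lambda>) + \<lambda>\<rho>\<close> for every \<open>\<lambda> \<ge> 0\<close>, where \<open>\<phi>(\<lambda>) = E (r(v) - \<lambda> c(v))\<^sup>+\<close> and
  \<open>r\<close>, \<open>c\<close> are the expected reward and cost. In a round whose two estimates are within
  \<open>\<epsilon>\<^sub>t v\<^sub>t\<close> of \<open>r(v\<^sub>t)\<close>, \<open>c(v\<^sub>t)\<close>, optimism gives
  \<open>(r(v\<^sub>t) - \<lambda>\<^sub>t c(v\<^sub>t))\<^sup>+ \<le> x\<^sub>t (\<^bold>r\<^sub>t - \<lambda>\<^sub>t \<^bold>c\<^sub>t)\<close> with the estimates \<open>\<^bold>r\<^sub>t\<close>, \<open>\<^bold>c\<^sub>t\<close>.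
  Summing, the multiplier terms are handled by the regret of online gradient descent against
  the comparator \<open>0\<close> if the budget lasts and \<open>vbar/\<rho>\<close> if it runs out; in the latter case the
  spent budget pays for the lost rounds. The multipliers stay bounded because a purchase
  with \<open>\<^bold>c\<^sub>t > \<rho>\<close> needs \<open>\<lambda>\<^sub>t \<rho> \<le> \<^bold>r\<^sub>t\<close>.

  The estimates are not required to hold uniformly in \<open>v\<close>, so no
  Dvoretzky-Kiefer-Wolfowitz inequality is needed: rounds with a bad estimate are tolerated, as
  long as there are \<open>O(\<surd>T)\<close> of them. As \<open>v\<^sub>t\<close> is independent of the past, an exponential
  supermartingale for fixed \<open>v\<close>, with one parameter per block \<open>4\<^sup>j \<le> n < 4\<^sup>j\<^sup>+\<^sup>1\<close> of sample sizes,
  bounds the probability of a bad round by \<open>O(T\<^bsup>-16/9\<^esup> ln T)\<close>, and Markov's inequality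
  applies to the number of bad rounds.
\<close>

section \<open>Exponential supermartingales on finite products\<close>

lemma (in prob_space) expectation_in_interval:
  assumes [measurable]: "f \<in> borel_measurable M" and "AE x in M. f x \<in> {a..b::real}"
  shows "integrable M f" "expectation f \<in> {a..b}"
proof -
  show i: "integrable M f"
  proof (rule integrable_const_bound)
    show "AE x in M. norm (f x) \<le> max \<bar>a\<bar> \<bar>b\<bar>" using assms(2) by eventually_elim auto
  qed simp
  have "AE x in M. a \<le> f x" "AE x in M. f x \<le> b" using assms(2) by auto
  then show "expectation f \<in> {a..b}"
    using integral_ge_const[OF i] integral_le_const[OF i] by auto
qed

text \<open>Hoeffding's lemma with its compensator moved into the exponent, which is the shape of
  one supermartingale step. A negative \<open>s\<close> is reduced to a positive one by passing to
  \<open>- f\<close>.\<close>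

lemma (in prob_space) Hoeffding_mgf_le_1:
  fixes f :: "'a \<Rightarrow> real"
  assumes [measurable]: "f \<in> borel_measurable M" and bnd: "AE x in M. f x \<in> {0..b}"
  shows "(\<integral>\<^sup>+x. ennreal (exp (s * (f x - expectation f) - s\<^sup>2 * b\<^sup>2 / 8)) \<partial>M) \<le> 1"
proof -
  have main: "(\<integral>\<^sup>+x. ennreal (exp (l * (g x - expectation g) - l\<^sup>2 * (b' - a')\<^sup>2 / 8)) \<partial>M) \<le> 1"
    if "l > 0" and [measurable]: "g \<in> borel_measurable M" and "AE x in M. g x \<in> {a'..b'}"
    for l a' b' :: real and g :: "'a \<Rightarrow> real"
  proof -
    interpret interval_bounded_random_variable M g a' b'
      by unfold_locales (fact that)+
    let ?c = "l\<^sup>2 * (b' - a')\<^sup>2 / 8"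
    have "(\<integral>\<^sup>+x. ennreal (exp (l * (g x - expectation g) - ?c)) \<partial>M)
        = (\<integral>\<^sup>+x. ennreal (exp (l * (g x - expectation g))) * ennreal (exp (- ?c)) \<partial>M)"
      by (simp only: diff_conv_add_uminus exp_add ennreal_mult exp_ge_zero)
    also have "\<dots> = (\<integral>\<^sup>+x. ennreal (exp (l * (g x - expectation g))) \<partial>M) * ennreal (exp (- ?c))"
      by (rule nn_integral_multc) measurable
    also have "\<dots> \<le> ennreal (exp ?c) * ennreal (exp (- ?c))"
      by (intro mult_right_mono Hoeffdings_lemma_nn_integral that(1)) simp
    also have "\<dots> = 1"
      by (simp flip: ennreal_mult exp_add)
    finally show ?thesis .
  qed
  consider "s > 0" | "s = 0" | "s < 0" by linarith
  then show ?thesis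
  proof cases
    case 1
    show ?thesis using main[OF 1, of f 0 b] bnd by simp
  next
    case 2
    have "emeasure M (space M) \<le> 1" using emeasure_space_1 by (rule eq_refl)
    then show ?thesis by (simp add: 2)
  next
    case 3
    have "AE x in M. - f x \<in> {-b..0}" using bnd by eventually_elim auto
    then show ?thesis using main[of "-s" "\<lambda>x. - f x" "-b" 0] 3 by (simp add: algebra_simps)
  qed
qed

context prob_space
begin

text \<open>Fubini integrates out the last coordinate first: \<open>adapted\<close> pulls the
  earlier increments out of the inner integral, and \<open>step\<close> bounds what is left by 1.
  Increments count from 0 and coordinates from 1, so \<open>d j\<close> may depend on coordinates up
  to \<open>Suc j\<close>.\<close>

lemma nn_integral_exp_sum_PiM_le_1:
  fixes d :: "nat \<Rightarrow> (nat \<Rightarrow> 'a) \<Rightarrow> real"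
  assumes meas: "\<And>j k. j < k \<Longrightarrow> k \<le> n \<Longrightarrow> d j \<in> borel_measurable (PiM {1..k} (\<lambda>_. M))"
    and adapted: "\<And>j k x y. j < k \<Longrightarrow> k < n \<Longrightarrow> d j (x(Suc k := y)) = d j x"
    and step: "\<And>k x. k < n \<Longrightarrow> x \<in> space (PiM {1..k} (\<lambda>_. M)) \<Longrightarrow>
      (\<integral>\<^sup>+y. ennreal (exp (d k (x(Suc k := y)))) \<partial>M) \<le> 1"
  shows "(\<integral>\<^sup>+x. ennreal (exp (\<Sum>j<n. d j x)) \<partial>PiM {1..n} (\<lambda>_. M)) \<le> 1"
proof -
  interpret P: product_prob_space "\<lambda>_. M" by unfold_locales
  have "(\<integral>\<^sup>+x. ennreal (exp (\<Sum>j<k. d j x)) \<partial>PiM {1..k} (\<lambda>_. M)) \<le> 1" if "k \<le> n" for k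
    using that
  proof (induction k)
    case 0
    interpret Q: prob_space "PiM ({} :: nat set) (\<lambda>_. M)" by (intro prob_space_PiM) unfold_locales
    show ?case using Q.emeasure_space_1 by simp
  next
    case (Suc k)
    have ins: "{1..Suc k} = insert (Suc k) {1..k}" by auto
    have dm: "d j \<in> borel_measurable (PiM (insert (Suc k) {1..k}) (\<lambda>_. M))" if "j < Suc k" for j
      using meas[OF that Suc.prems] ins by simp
    have sm: "(\<lambda>x. \<Sum>j<Suc k. d j x) \<in> borel_measurable (PiM (insert (Suc k) {1..k}) (\<lambda>_. M))"
      by (intro borel_measurable_sum dm) auto
    have "(\<integral>\<^sup>+x. ennreal (exp (\<Sum>j<Suc k. d j x)) \<partial>PiM {1..Suc k} (\<lambda>_. M))
       = (\<integral>\<^sup>+x. (\<integral>\<^sup>+y. ennreal (exp (\<Sum>j<Suc k. d j (x(Suc k := y)))) \<partial>M) \<partial>PiM {1..k} (\<lambda>_. M))"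
    proof (unfold ins, rule P.product_nn_integral_insert)
      show "(\<lambda>x. ennreal (exp (\<Sum>j<Suc k. d j x))) \<in> borel_measurable (PiM (insert (Suc k) {1..k}) (\<lambda>_. M))"
        by (rule measurable_compose[OF sm]) simp
    qed auto
    also have "\<dots> = (\<integral>\<^sup>+x. ennreal (exp (\<Sum>j<k. d j x)) *
        (\<integral>\<^sup>+y. ennreal (exp (d k (x(Suc k := y)))) \<partial>M) \<partial>PiM {1..k} (\<lambda>_. M))"
    proof (rule nn_integral_cong)
      fix x assume x: "x \<in> space (PiM {1..k} (\<lambda>_. M))"
      have xm: "(\<lambda>y. x(Suc k := y)) \<in> measurable M (PiM (insert (Suc k) {1..k}) (\<lambda>_. M))"
        using x by (intro measurable_fun_upd[where J="{1..k}"]) auto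
      have "(\<lambda>y. d k (x(Suc k := y))) \<in> borel_measurable M"
        by (rule measurable_compose[OF xm dm]) simp
      then show "(\<integral>\<^sup>+y. ennreal (exp (\<Sum>j<Suc k. d j (x(Suc k := y)))) \<partial>M) =
         ennreal (exp (\<Sum>j<k. d j x)) * (\<integral>\<^sup>+y. ennreal (exp (d k (x(Suc k := y)))) \<partial>M)"
        using Suc.prems adapted[of _ k x]
        by (subst nn_integral_cmult[symmetric]) (auto simp: exp_add ennreal_mult)
    qed
    also have "\<dots> \<le> (\<integral>\<^sup>+x. ennreal (exp (\<Sum>j<k. d j x)) * 1 \<partial>PiM {1..k} (\<lambda>_. M))"
      using Suc.prems by (intro nn_integral_mono mult_left_mono step) auto
    also have "\<dots> \<le> 1" using Suc by simp
    finally show ?case .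
  qed
  then show ?thesis by simp
qed

lemma Azuma_Hoeffding_PiM:
  fixes D :: "nat \<Rightarrow> (nat \<Rightarrow> 'a) \<Rightarrow> real"
  assumes meas: "\<And>j k. j < k \<Longrightarrow> k \<le> n \<Longrightarrow> D j \<in> borel_measurable (PiM {1..k} (\<lambda>_. M))"
    and adapted: "\<And>j k x y. j < k \<Longrightarrow> k < n \<Longrightarrow> D j (x(Suc k := y)) = D j x"
    and step: "\<And>k x s. k < n \<Longrightarrow> x \<in> space (PiM {1..k} (\<lambda>_. M)) \<Longrightarrow>
      (\<integral>\<^sup>+y. ennreal (exp (s * D k (x(Suc k := y)) - s\<^sup>2 * b\<^sup>2 / 8)) \<partial>M) \<le> 1"
    and "0 < b" "0 < n" "0 \<le> a"
  shows "measure (PiM {1..n} (\<lambda>_. M)) {x \<in> space (PiM {1..n} (\<lambda>_. M)). a < (\<Sum>j<n. D j x)}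
     \<le> exp (- 2 * a\<^sup>2 / (real n * b\<^sup>2))"
proof -
  let ?P = "PiM {1..n} (\<lambda>_. M)"
  interpret Q: prob_space ?P by (intro prob_space_PiM) unfold_locales
  \<comment> \<open>The minimiser of the Chernoff exponent
    \<open>n * s^2 * b^2 / 8 - s * a\<close>.\<close>
  define s where "s = 4 * a / (real n * b\<^sup>2)"
  have s0: "s \<ge> 0" using assms by (simp add: s_def)
  have Dm: "D j \<in> borel_measurable ?P" if "j < n" for j
    using meas[OF that] by simp
  let ?d = "\<lambda>j x. s * D j x - s\<^sup>2 * b\<^sup>2 / 8"
  let ?c = "2 * a\<^sup>2 / (real n * b\<^sup>2)"
  have int: "(\<integral>\<^sup>+x. ennreal (exp (\<Sum>j<n. ?d j x)) \<partial>?P) \<le> 1"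
    by (rule nn_integral_exp_sum_PiM_le_1) (use meas adapted step in auto)
  have "emeasure ?P {x \<in> space ?P. a < (\<Sum>j<n. D j x)} =
      (\<integral>\<^sup>+x. indicator {x \<in> space ?P. a < (\<Sum>j<n. D j x)} x \<partial>?P)"
    by (rule nn_integral_indicator[symmetric]) (use Dm in measurable)
  also have "\<dots> \<le> (\<integral>\<^sup>+x. ennreal (exp (- ?c)) * ennreal (exp (\<Sum>j<n. ?d j x)) \<partial>?P)"
  proof (rule nn_integral_mono)
    fix x
    have "1 \<le> exp (- ?c) * exp (\<Sum>j<n. ?d j x)" if "a < (\<Sum>j<n. D j x)"
    proof -
      have "(\<Sum>j<n. ?d j x) = s * (\<Sum>j<n. D j x) - real n * (s\<^sup>2 * b\<^sup>2 / 8)"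
        by (simp add: sum_subtractf sum_distrib_left)
      also have "\<dots> \<ge> s * a - real n * (s\<^sup>2 * b\<^sup>2 / 8)"
        using that s0 by (simp add: mult_left_mono)
      also have "s * a - real n * (s\<^sup>2 * b\<^sup>2 / 8) = ?c"
        using \<open>0 < b\<close> \<open>0 < n\<close> by (simp add: s_def field_simps power2_eq_square)
      finally show ?thesis by (simp flip: exp_add)
    qed
    then show "indicator {x \<in> space ?P. a < (\<Sum>j<n. D j x)} x
       \<le> ennreal (exp (- ?c)) * ennreal (exp (\<Sum>j<n. ?d j x))"
      by (auto simp: indicator_def simp flip: ennreal_mult intro!: ennreal_leI)
  qed
  also have "\<dots> = ennreal (exp (- ?c)) * (\<integral>\<^sup>+x. ennreal (exp (\<Sum>j<n. ?d j x)) \<partial>?P)"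
    by (rule nn_integral_cmult) (use Dm in measurable)
  also have "\<dots> \<le> ennreal (exp (- ?c)) * 1"
    by (intro mult_left_mono int) auto
  finally have "ennreal (measure ?P {x \<in> space ?P. a < (\<Sum>j<n. D j x)}) \<le> ennreal (exp (- ?c))"
    unfolding Q.emeasure_eq_measure mult_1_right .
  then show ?thesis
    by (subst (asm) ennreal_le_iff) (auto simp del: One_nat_def)
qed

text \<open>Each coordinate beyond \<open>k\<close> integrates a constant against a probability
  measure. This serves to forget the rounds after the one whose estimates are tested.\<close>

lemma nn_integral_PiM_initial_segment:
  fixes g :: "(nat \<Rightarrow> 'a) \<Rightarrow> ennreal"
  assumes "k \<le> n" and meas: "\<And>m. k \<le> m \<Longrightarrow> g \<in> borel_measurable (PiM {1..m} (\<lambda>_. M))"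
    and adapted: "\<And>m x y. k \<le> m \<Longrightarrow> g (x(Suc m := y)) = g x"
  shows "(\<integral>\<^sup>+x. g x \<partial>PiM {1..n} (\<lambda>_. M)) = (\<integral>\<^sup>+x. g x \<partial>PiM {1..k} (\<lambda>_. M))"
  using \<open>k \<le> n\<close>
proof (induction n rule: dec_induct)
  case (step m)
  interpret P: product_prob_space "\<lambda>_. M" by unfold_locales
  have ins: "{1..Suc m} = insert (Suc m) {1..m}" by auto
  have "(\<integral>\<^sup>+x. g x \<partial>PiM {1..Suc m} (\<lambda>_. M))
       = (\<integral>\<^sup>+x. (\<integral>\<^sup>+y. g (x(Suc m := y)) \<partial>M) \<partial>PiM {1..m} (\<lambda>_. M))"
  proof (unfold ins, rule P.product_nn_integral_insert)
    show "g \<in> borel_measurable (PiM (insert (Suc m) {1..m}) (\<lambda>_. M))"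
      using meas[of "Suc m"] step(1) unfolding ins by linarith
  qed auto
  also have "\<dots> = (\<integral>\<^sup>+x. g x \<partial>PiM {1..m} (\<lambda>_. M))"
    using emeasure_space_1 step(1) by (simp add: adapted)
  finally show ?case using step by simp
qed simp

end

section \<open>Regret on a sample path\<close>

text \<open>Bounds by differences, so that sums along a growing sample size telescope. Both rest on
  \<open>sqrt (x + 1) - sqrt x = 1 / (sqrt x + sqrt (x + 1))\<close> and on the two roots being
  within a factor 3/2.\<close>

lemma inverse_sqrt_le_diff:
  fixes x :: real assumes "1 \<le> x"
  shows "1 / sqrt x \<le> 3 * (sqrt (x + 1) - sqrt x)"
    and "1 / (x * sqrt x) \<le> 4 * (1 / sqrt x - 1 / sqrt (x + 1))"
proof -
  define a where "a = sqrt x"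
  define b where "b = sqrt (x + 1)"
  have a: "1 \<le> a" "a\<^sup>2 = x" and b: "b\<^sup>2 = x + 1" "0 < b" using assms by (auto simp: a_def b_def)
  have ab: "a \<le> b" by (simp add: a_def b_def)
  \<comment> \<open>Here \<open>x + 1 <= 2 * x\<close>, and 2 is below 9/4, the square of
    3/2.\<close>
  have ba: "b \<le> 3/2 * a"
    by (rule power2_le_imp_le) (use a b assms in \<open>auto simp: power_mult_distrib power_divide\<close>)
  have diff: "b - a = 1 / (a + b)"
    using a b by (simp add: field_simps power2_eq_square)
  have d: "2 / 5 / a \<le> b - a"
    unfolding diff using a b ba by (simp add: field_simps)
  show "1 / sqrt x \<le> 3 * (sqrt (x + 1) - sqrt x)"
    unfolding a_def[symmetric] b_def[symmetric]
    using d a by (simp add: field_simps)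
  have "1 / (a\<^sup>2 * a) = (2 / 5 / a) * (5 / 2) / (a * a)"
    using a by (simp add: field_simps power2_eq_square)
  also have "\<dots> \<le> (b - a) * (5 / 2) / (a * a)"
    using d a by (intro divide_right_mono mult_right_mono) auto
  also have "\<dots> \<le> (b - a) * (5 / 2) / (a * (b * (2 / 3)))"
    using a b ab ba by (intro divide_left_mono mult_left_mono) (auto simp: field_simps)
  also have "\<dots> = 15 / 4 * (1 / a - 1 / b)"
    using a b by (simp add: field_simps)
  also have "\<dots> \<le> 4 * (1 / a - 1 / b)"
    using a b diff by (intro mult_right_mono) (auto simp: field_simps ab)
  finally show "1 / (x * sqrt x) \<le> 4 * (1 / sqrt x - 1 / sqrt (x + 1))"
    unfolding a_def[symmetric] b_def[symmetric] a(2) .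
qed

lemma sum_inverse_sqrt_le: "(\<Sum>j\<in>{1..<k}. 1 / sqrt (real (Suc j))) \<le> 2 * sqrt (real k)"
proof (induction k)
  case (Suc k)
  have "1 / sqrt (real (Suc k)) \<le> 2 * (sqrt (real (Suc k)) - sqrt (real k))"
  proof -
    define a where "a = sqrt (real k)"
    define b where "b = sqrt (real (Suc k))"
    have ab: "0 \<le> a" "a \<le> b" "0 < b" "b\<^sup>2 = a\<^sup>2 + 1" by (auto simp: a_def b_def)
    \<comment> \<open>Because \<open>b^2 = a^2 + 1\<close>, this square equals
      \<open>2 * (b - a) * b - 1\<close>.\<close>
    have "(b - a)\<^sup>2 \<ge> 0" by simp
    then have "1 \<le> 2 * (b - a) * b" using ab by (simp add: power2_eq_square algebra_simps)
    then show ?thesis unfolding a_def[symmetric] b_def[symmetric] using ab by (simp add: field_simps)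
  qed
  then show ?case using Suc by (cases "k = 0") (auto simp: sum.atLeastLessThan_Suc)
qed simp

lemma rew_bounds: "0 \<le> p \<Longrightarrow> 0 \<le> v \<Longrightarrow> rew v p \<in> {0..v}"
  by (auto simp: rew_def)

lemma cost_bounds: "0 \<le> p \<Longrightarrow> 0 \<le> v \<Longrightarrow> cost v p \<in> {0..v}"
  by (auto simp: cost_def)

lemma mean_bounds:
  fixes g :: "'a \<Rightarrow> real"
  assumes "finite I" "I \<noteq> {}" "\<And>i. i \<in> I \<Longrightarrow> g i \<in> {0..b}"
  shows "(\<Sum>i\<in>I. g i) / real (card I) \<in> {0..b}"
proof -
  have "(\<Sum>i\<in>I. g i) \<le> real (card I) * b"
    using assms(3) by (intro sum_bounded_above) auto
  moreover have "0 \<le> (\<Sum>i\<in>I. g i)" using assms(3) by (intro sum_nonneg) auto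
  moreover have "card I > 0" using assms by (simp add: card_gt_0_iff)
  ultimately show ?thesis by (auto simp: field_simps)
qed

section \<open>State variables of a run and their invariants\<close>

locale ogd =
  fixes vbar \<rho> :: real and T :: nat
  assumes vbar_pos: "0 < vbar" and rho_pos: "0 < \<rho>" and rho_le: "\<rho> \<le> vbar"
begin

text \<open>The index counts completed rounds: \<open>mult v p k\<close> is the multiplier used in
  round \<open>Suc k\<close>, and the first round is \<open>k = 0\<close>.\<close>

definition obs where "obs v p k = fst (ogd_run vbar \<rho> T v p k)"
definition bud where "bud v p k = fst (snd (ogd_run vbar \<rho> T v p k))"
definition mult where "mult v p k = fst (snd (snd (ogd_run vbar \<rho> T v p k)))"
definition live where "live v p k = fst (snd (snd (snd (ogd_run vbar \<rho> T v p k))))"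
definition rev where "rev v p k = snd (snd (snd (snd (ogd_run vbar \<rho> T v p k))))"

abbreviation rt where "rt v p k \<equiv> ogd_rt T (obs v p k) p (v (Suc k))"
abbreviation ct where "ct v p k \<equiv> ogd_ct T (obs v p k) p (v (Suc k))"
abbreviation eps where "eps v p k \<equiv> ogd_eps T (obs v p k)"
abbreviation cnt where "cnt v p k \<equiv> real (card (obs v p k))"

text \<open>\<open>live\<close> is part of the decision, so sums of selected rounds over the whole
  horizon stop by themselves at the ending time.\<close>

definition sel where
  "sel v p k \<longleftrightarrow> live v p k \<and> (k = 0 \<or> mult v p k * ct v p k \<le> rt v p k)"

lemma state_0: "obs v p 0 = {}" "bud v p 0 = \<rho> * real T" "mult v p 0 = 0" "live v p 0" "rev v p 0 = 0"
  by (auto simp: obs_def bud_def mult_def live_def rev_def)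

lemma state_Suc:
  "obs v p (Suc k) = (if sel v p k then insert (Suc k) (obs v p k) else obs v p k)"
  "bud v p (Suc k) = bud v p k - of_bool (sel v p k) * cost (v (Suc k)) (p (Suc k))"
  "mult v p (Suc k) = (if live v p k \<and> k \<noteq> 0 then max 0 (mult v p k +
     1 / (vbar * sqrt (real (Suc k))) * (of_bool (sel v p k) * ct v p k - \<rho>)) else mult v p k)"
  "live v p (Suc k) \<longleftrightarrow> live v p k \<and> vbar \<le> bud v p (Suc k)"
  "rev v p (Suc k) = rev v p k + of_bool (sel v p k) * rew (v (Suc k)) (p (Suc k))"
  by (auto simp: obs_def bud_def mult_def live_def rev_def sel_def Let_def not_less split: prod.splits)

lemma sel_0: "sel v p 0"
  by (simp add: sel_def state_0)

lemma obs_subset: "obs v p k \<subseteq> {1..k}"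
  by (induction k) (auto simp: state_0 state_Suc)

lemma finite_obs [simp]: "finite (obs v p k)"
  using obs_subset by (rule finite_subset) simp

text \<open>Trades the path-dependent index set for a fixed range with indicators, the form needed
  for measurability and for martingale sums.\<close>

lemma sum_obs: "(\<Sum>\<tau>\<in>obs v p k. g \<tau>) = (\<Sum>j<k. of_bool (sel v p j) * (g (Suc j) :: real))"
proof (induction k)
  case (Suc k)
  have "Suc k \<notin> obs v p k" using obs_subset[of v p k] by auto
  then show ?case using Suc by (simp add: state_Suc)
qed (simp add: state_0)

lemma cnt_eq: "cnt v p k = (\<Sum>j<k. of_bool (sel v p j))"
  using sum_obs[where g="\<lambda>_. 1"] by simp

lemma cnt_Suc: "cnt v p (Suc k) = cnt v p k + of_bool (sel v p k)"
  by (simp add: cnt_eq)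

text \<open>The forced purchase in the first round provides a sample, so from \<open>k = 1\<close>
  on no estimate divides by zero.\<close>

lemma obs_nonempty: "1 \<le> k \<Longrightarrow> obs v p k \<noteq> {}"
  by (induction k rule: dec_induct) (auto simp: state_Suc sel_0)

lemma cnt_ge_1: "1 \<le> k \<Longrightarrow> 1 \<le> cnt v p k"
  using obs_nonempty[of k v p] by (simp add: Suc_le_eq card_gt_0_iff)

lemma cnt_le: "cnt v p k \<le> real k"
  using card_mono[OF _ obs_subset[of v p k]] by simp

lemma rev_eq: "rev v p k = (\<Sum>j<k. of_bool (sel v p j) * rew (v (Suc j)) (p (Suc j)))"
  by (induction k) (auto simp: state_0 state_Suc)

lemma bud_eq: "bud v p k = \<rho> * real T - (\<Sum>j<k. of_bool (sel v p j) * cost (v (Suc j)) (p (Suc j)))"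
  by (induction k) (auto simp: state_0 state_Suc)

lemma live_antimono: "j \<le> k \<Longrightarrow> live v p k \<Longrightarrow> live v p j"
  by (induction k rule: dec_induct) (auto simp: state_Suc)

text \<open>The run stops only when the budget falls below \<open>vbar\<close>, and nothing is spent
  afterwards.\<close>

lemma not_live_bud: "\<not> live v p k \<Longrightarrow> bud v p k < vbar"
proof (induction k)
  case (Suc k)
  show ?case
  proof (cases "live v p k")
    case False
    then have "bud v p (Suc k) = bud v p k" by (simp add: state_Suc sel_def)
    then show ?thesis using Suc False by simp
  qed (use Suc in \<open>auto simp: state_Suc(4)\<close>)
qed (simp add: state_0)

lemma mult_nonneg: "0 \<le> mult v p k"
  by (induction k) (auto simp: state_0 state_Suc)

lemma eps_nonneg: "1 \<le> T \<Longrightarrow> 0 \<le> eps v p k"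
  unfolding ogd_eps_def by (intro real_sqrt_ge_zero divide_nonneg_nonneg) auto

lemma eps_eq: "eps v p k = sqrt ((ln 2 + 2 * ln (real T)) / 2) / sqrt (cnt v p k)"
  by (simp add: ogd_eps_def real_sqrt_divide real_sqrt_mult field_simps)

text \<open>The first summand bounds the multipliers at which a rise is still possible, and 1 bounds
  a single rise; see \<open>mult_le\<close>.\<close>

definition lam_max where "lam_max = 3 / 2 * vbar / \<rho> + 1"

text \<open>In \<open>regret_bound\<close>, comparator 0 leads to 67 and the square of
  \<open>lam_max\<close>. Comparator \<open>vbar / \<rho>\<close> adds 12 for confidence widths, 15
  for bad rounds and 3 for the budget.\<close>

definition regret_const where
  "regret_const = 67 * vbar + 30 * vbar * (vbar / \<rho>) + vbar / 2 * lam_max\<^sup>2"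

text \<open>The estimates are tested only at the value of the current round. The functions
  \<open>r\<close> and \<open>c\<close> stay arbitrary here and later become the expected reward and
  cost.\<close>

definition bad where
  "bad r c v p k \<longleftrightarrow>
     \<not> (\<bar>(\<Sum>\<tau>\<in>obs v p k. rew (v (Suc k)) (p \<tau>)) / cnt v p k - r (v (Suc k))\<bar> \<le> eps v p k * v (Suc k) \<and>
        \<bar>(\<Sum>\<tau>\<in>obs v p k. cost (v (Suc k)) (p \<tau>)) / cnt v p k - c (v (Suc k))\<bar> \<le> eps v p k * v (Suc k))"

text \<open>\<open>cnt\<close> grows by one exactly in the selected rounds, so these are sums over
  consecutive sample sizes and telescope by \<open>inverse_sqrt_le_diff\<close>.\<close>

lemma sum_sel_inverse_sqrt:
  assumes "1 \<le> k"
  shows "(\<Sum>j\<in>{1..<k}. of_bool (sel v p j) * (1 / sqrt (cnt v p j))) \<le> 3 * sqrt (cnt v p k)"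
    and "(\<Sum>j\<in>{1..<k}. of_bool (sel v p j) * (1 / (cnt v p j * sqrt (cnt v p j)))) \<le>
      4 * (1 - 1 / sqrt (cnt v p k))"
  using assms
proof (induction k rule: dec_induct)
  case base
  { case 1 show ?case by simp }
  { case 2
    have "1 \<le> sqrt (cnt v p 1)" using cnt_ge_1[of 1 v p] by simp
    then show ?case by (simp add: field_simps) }
next
  case (step k)
  have c: "1 \<le> cnt v p k" using cnt_ge_1 step by simp
  { case 1 show ?case
      using step inverse_sqrt_le_diff(1)[OF c] by (auto simp: cnt_Suc sum.atLeastLessThan_Suc)}
  { case 2 show ?case
      using step inverse_sqrt_le_diff(2)[OF c] by (auto simp: cnt_Suc sum.atLeastLessThan_Suc)}
qed

end

section \<open>Deterministic analysis of online gradient descent\<close>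

locale ogd_path = ogd +
  fixes v p :: "nat \<Rightarrow> real"
  assumes v_range: "\<And>t. t \<in> {1..T} \<Longrightarrow> v t \<in> {0..vbar}"
    and p_range: "\<And>t. t \<in> {1..T} \<Longrightarrow> p t \<in> {0..vbar}"
begin

abbreviation rhat where "rhat k \<equiv> (\<Sum>\<tau>\<in>obs v p k. rew (v (Suc k)) (p \<tau>)) / cnt v p k"
abbreviation chat where "chat k \<equiv> (\<Sum>\<tau>\<in>obs v p k. cost (v (Suc k)) (p \<tau>)) / cnt v p k"

lemma rt_eq: "rt v p k = rhat k + eps v p k * v (Suc k)"
  by (simp add: ogd_rt_def)

lemma ct_eq: "ct v p k = chat k - 2 * eps v p k * v (Suc k)"
  by (simp add: ogd_ct_def)

lemma hat_bounds:
  assumes "1 \<le> k" "k < T"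
  shows "rhat k \<in> {0..v (Suc k)}" "chat k \<in> {0..v (Suc k)}"
proof -
  have v0: "0 \<le> v (Suc k)" using v_range[of "Suc k"] assms by auto
  have p0: "0 \<le> p \<tau>" if "\<tau> \<in> obs v p k" for \<tau>
    using p_range[of \<tau>] obs_subset[of v p k] that assms by auto
  show "rhat k \<in> {0..v (Suc k)}"
    by (rule mean_bounds) (use obs_nonempty assms rew_bounds p0 v0 in auto)
  show "chat k \<in> {0..v (Suc k)}"
    by (rule mean_bounds) (use obs_nonempty assms cost_bounds p0 v0 in auto)
qed

lemma mult_le: "k \<le> T \<Longrightarrow> mult v p k \<le> lam_max"
proof (induction k)
  case 0
  then show ?case using vbar_pos rho_pos by (simp add: state_0 lam_max_def)
next
  case (Suc k)
  show ?case
  proof (cases "live v p k \<and> k \<noteq> 0")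
    case False
    then show ?thesis using Suc by (auto simp: state_Suc)
  next
    case True
    define l0 where "l0 = mult v p k"
    define g where "g = of_bool (sel v p k) * ct v p k - \<rho>"
    define \<eta> where "\<eta> = 1 / (vbar * sqrt (real (Suc k)))"
    have \<eta>0: "\<eta> > 0" using vbar_pos by (simp add: \<eta>_def)
    have lam: "l0 \<le> lam_max" "0 \<le> l0" using Suc mult_nonneg by (auto simp: l0_def)
    have lm: "0 \<le> lam_max" using lam by simp
    have M: "mult v p (Suc k) = max 0 (l0 + \<eta> * g)"
      using True by (simp add: state_Suc l0_def g_def \<eta>_def)
    show ?thesis
    proof (cases "g \<le> 0")
      case True
      then have "\<eta> * g \<le> 0" using \<eta>0 by (simp add: mult_nonneg_nonpos)
      then show ?thesis unfolding M using lam lm by simp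
    next
      case False
      \<comment> \<open>Without a purchase the gradient is \<open>- \<rho>\<close>, so a rise
        requires a purchase whose pessimistic cost exceeds \<open>\<rho>\<close>.\<close>
      then have s: "sel v p k" and ct: "\<rho> < ct v p k" using rho_pos by (cases "sel v p k"; simp add: g_def)+
      have k: "1 \<le> k" "k < T" using True Suc.prems by auto
      note hb = hat_bounds[OF k]
      have vk: "0 \<le> v (Suc k)" "v (Suc k) \<le> vbar" using v_range[of "Suc k"] k by auto
      have e0: "0 \<le> eps v p k" using eps_nonneg k by simp
      have ev0: "0 \<le> eps v p k * v (Suc k)" using e0 vk by simp
      \<comment> \<open>A positive pessimistic cost limits the width: \<open>chat k\<close> is at
        most the value, so twice the width is too. Hence the optimistic reward is at most 3/2 of the
        value.\<close>
      have ev: "2 * (eps v p k * v (Suc k)) \<le> v (Suc k)" using ct hb rho_pos unfolding ct_eq by simp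
      have ctle: "ct v p k \<le> vbar" unfolding ct_eq using hb vk ev0 by simp
      have "l0 * \<rho> \<le> l0 * ct v p k" using ct lam by (intro mult_left_mono) auto
      also have "\<dots> \<le> rt v p k" using s k by (simp add: sel_def l0_def)
      also have "\<dots> \<le> 3 / 2 * vbar" unfolding rt_eq using hb vk ev unfolding atLeastAtMost_iff by linarith
      finally have l1: "l0 \<le> 3 / 2 * vbar / \<rho>" using rho_pos by (simp add: field_simps)
      have "g \<le> vbar" using ctle s rho_pos by (simp add: g_def)
      then have "\<eta> * g \<le> \<eta> * vbar" using \<eta>0 by (intro mult_left_mono) auto
      \<comment> \<open>The step size times \<open>vbar\<close> is
        \<open>1 / sqrt (Suc k)\<close>.\<close>
      also have "\<dots> \<le> 1" using vbar_pos by (simp add: \<eta>_def)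
      finally show ?thesis unfolding M using l1 lm by (simp add: lam_max_def)
    qed
  qed
qed

text \<open>The usual one-step inequality of gradient descent, scaled by half the inverse step size.
  The gradient is not bounded by \<open>vbar\<close>: pessimism can make the cost estimate negative,
  which costs an extra \<open>eps^2\<close> term in rounds with a purchase.\<close>

lemma ogd_step:
  assumes "1 \<le> k" "k < T" "0 \<le> l0"
  defines "g \<equiv> of_bool (sel v p k) * ct v p k - \<rho>"
  shows "of_bool (live v p k) * ((mult v p k - l0) * (- g)) \<le>
     vbar * sqrt (real (Suc k)) / 2 * ((mult v p k - l0)\<^sup>2 - (mult v p (Suc k) - l0)\<^sup>2)
     + vbar * (1 / sqrt (real (Suc k))) + 4 * vbar * (of_bool (sel v p k) * ((eps v p k)\<^sup>2 * (1 / sqrt (real (Suc k)))))"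
proof (cases "live v p k")
  case False
  then show ?thesis using assms vbar_pos by (simp add: state_Suc)
next
  case True
  define q where "q = sqrt (real (Suc k))"
  define l where "l = mult v p k"
  define \<eta> where "\<eta> = 1 / (vbar * q)"
  define e where "e = eps v p k"
  define X where "X = (of_bool (sel v p k) :: real)"
  have X: "X = 0 \<or> X = 1" by (simp add: X_def)
  have q0: "q > 0" by (simp add: q_def)
  have e0: "0 \<le> e" using eps_nonneg assms by (simp add: e_def)
  have M: "mult v p (Suc k) = max 0 (l + \<eta> * g)"
    using True assms by (simp add: state_Suc l_def g_def \<eta>_def q_def)
  \<comment> \<open>Projection to the nonnegative reals does not increase the distance to
    \<open>l0\<close>, which is itself nonnegative.\<close>
  have "(max 0 (l + \<eta> * g) - l0)\<^sup>2 \<le> (l + \<eta> * g - l0)\<^sup>2"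
    using assms(3) by (intro abs_le_square_iff[THEN iffD1]) auto
  then have "(mult v p (Suc k) - l0)\<^sup>2 \<le> (l - l0)\<^sup>2 + 2 * \<eta> * (g * (l - l0)) + \<eta>\<^sup>2 * g\<^sup>2"
    unfolding M by (simp add: power2_eq_square algebra_simps)
  then have "vbar * q / 2 * (mult v p (Suc k) - l0)\<^sup>2 \<le>
      vbar * q / 2 * ((l - l0)\<^sup>2 + 2 * \<eta> * (g * (l - l0)) + \<eta>\<^sup>2 * g\<^sup>2)"
    using vbar_pos q0 by (intro mult_left_mono) auto
  also have "\<dots> = vbar * q / 2 * (l - l0)\<^sup>2 + g * (l - l0) + g\<^sup>2 / (2 * vbar * q)"
    using vbar_pos q0 by (simp add: \<eta>_def field_simps power2_eq_square)
  finally have main: "(l - l0) * (- g) \<le> vbar * q / 2 * ((l - l0)\<^sup>2 - (mult v p (Suc k) - l0)\<^sup>2) + g\<^sup>2 / (2 * vbar * q)"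
    by (simp add: algebra_simps)
  have k: "1 \<le> k" "k < T" by fact+
  note hb = hat_bounds[OF k]
  have vk: "0 \<le> v (Suc k)" "v (Suc k) \<le> vbar" using v_range[of "Suc k"] k by auto
  have ev: "0 \<le> e * v (Suc k)" "e * v (Suc k) \<le> e * vbar" using e0 vk by (auto intro: mult_left_mono)
  have "\<bar>g\<bar> \<le> vbar + 2 * vbar * (X * e)"
    using X hb vk ev rho_pos rho_le unfolding g_def ct_eq X_def e_def[symmetric]
    by (auto simp: abs_le_iff algebra_simps)
  then have "g\<^sup>2 \<le> (vbar + 2 * vbar * (X * e))\<^sup>2"
    using vbar_pos by (intro abs_le_square_iff[THEN iffD1]) auto
  also have "\<dots> = vbar\<^sup>2 * (1 + 2 * (X * e))\<^sup>2" by (simp add: power2_eq_square algebra_simps)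
  also have "\<dots> \<le> vbar\<^sup>2 * (2 + 8 * (X * e\<^sup>2))"
  proof (intro mult_left_mono)
    \<comment> \<open>For \<open>X = 1\<close> the difference of the two sides is
      \<open>(1 - 2 * e)^2\<close>.\<close>
    show "(1 + 2 * (X * e))\<^sup>2 \<le> 2 + 8 * (X * e\<^sup>2)"
      using X zero_le_power2[of "1 - 2 * e"] by (auto simp: power2_eq_square algebra_simps)
  qed simp
  finally have "g\<^sup>2 / (2 * vbar * q) \<le> vbar\<^sup>2 * (2 + 8 * (X * e\<^sup>2)) / (2 * vbar * q)"
    using vbar_pos q0 by (intro divide_right_mono) auto
  also have "\<dots> = vbar * (1 / q) + 4 * vbar * (X * (e\<^sup>2 * (1 / q)))"
    using vbar_pos q0 by (simp add: field_simps power2_eq_square)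
  finally show ?thesis using main True
    unfolding l_def[symmetric] q_def[symmetric] e_def[symmetric] X_def[symmetric] by simp
qed

text \<open>Summation by parts with increasing weights. The square kept on the right carries the
  induction: raising the weight from \<open>sqrt k\<close> to \<open>sqrt (Suc k)\<close> is
  harmless because multiplier and comparator both lie between 0 and \<open>lam_max\<close>.\<close>

lemma telescope:
  assumes "1 \<le> k" "k \<le> T" "0 \<le> l0" "l0 \<le> lam_max"
  shows "(\<Sum>j\<in>{1..<k}. sqrt (real (Suc j)) * ((mult v p j - l0)\<^sup>2 - (mult v p (Suc j) - l0)\<^sup>2))
     \<le> sqrt (real k) * (lam_max\<^sup>2 - (mult v p k - l0)\<^sup>2)"
  using assms(1,2)
proof (induction k rule: dec_induct)
  have D: "(mult v p k - l0)\<^sup>2 \<le> lam_max\<^sup>2" if "k \<le> T" for k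
    using mult_le[OF that] mult_nonneg[of v p k] assms(3,4) by (intro abs_le_square_iff[THEN iffD1]) auto
  {
    case base
    then show ?case using D[of 1] by simp
  next
    case (step k)
    have "sqrt (real k) * (lam_max\<^sup>2 - (mult v p k - l0)\<^sup>2) \<le> sqrt (real (Suc k)) * (lam_max\<^sup>2 - (mult v p k - l0)\<^sup>2)"
      using D[of k] step by (intro mult_right_mono) auto
    then show ?case using step by (auto simp: sum.atLeastLessThan_Suc algebra_simps)
  }
qed

lemma log_bounds:
  assumes "1 \<le> ln (real T)"
  shows "(ln 2 + 2 * ln (real T)) / 2 \<le> 3 / 2 * ln (real T)"
    "ln (real T) \<le> sqrt (real T * ln (real T))"
    "sqrt (real T) \<le> sqrt (real T * ln (real T))"
    "1 \<le> sqrt (real T * ln (real T))" "1 \<le> T"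
proof -
  show T: "1 \<le> T" using assms by (cases T) auto
  have "ln (2::real) \<le> 1" using ln_le_minus_one[of "2::real"] by simp
  then show "(ln 2 + 2 * ln (real T)) / 2 \<le> 3 / 2 * ln (real T)" using assms by simp
  have "ln (real T) \<le> real T" using ln_le_minus_one[of "real T"] T by simp
  then have "ln (real T) * ln (real T) \<le> real T * ln (real T)"
    using assms by (intro mult_right_mono) auto
  then show "ln (real T) \<le> sqrt (real T * ln (real T))"
    by (intro real_le_rsqrt) (simp add: power2_eq_square)
  show sT: "sqrt (real T) \<le> sqrt (real T * ln (real T))"
    using mult_left_mono[OF assms, of "real T"] by simp
  have "1 \<le> sqrt (real T)" using T by simp
  then show "1 \<le> sqrt (real T * ln (real T))" using sT by linarith
qed

lemma sum_sel_eps_le: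
  assumes "1 \<le> ln (real T)"
  shows "(\<Sum>j\<in>{1..<T}. of_bool (sel v p j) * eps v p j) \<le> 4 * sqrt (real T * ln (real T))"
proof -
  note lb = log_bounds[OF assms]
  let ?q = "sqrt ((ln 2 + 2 * ln (real T)) / 2)"
  have q0: "0 \<le> ?q" using assms by simp
  have "(\<Sum>j\<in>{1..<T}. of_bool (sel v p j) * eps v p j) =
      ?q * (\<Sum>j\<in>{1..<T}. of_bool (sel v p j) * (1 / sqrt (cnt v p j)))"
    unfolding eps_eq by (simp add: sum_distrib_left mult_ac)
  also have "\<dots> \<le> ?q * (3 * sqrt (cnt v p T))"
    using q0 sum_sel_inverse_sqrt(1) lb(5) by (intro mult_left_mono) auto
  also have "\<dots> \<le> ?q * (3 * sqrt (real T))"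
    using q0 cnt_le by (intro mult_left_mono) auto
  also have "\<dots> \<le> sqrt (3 / 2 * ln (real T)) * (3 * sqrt (real T))"
    using lb(1) by (intro mult_right_mono) auto
  also have "\<dots> = (3 * sqrt (3 / 2)) * sqrt (real T * ln (real T))"
    by (simp only: real_sqrt_mult mult_ac)
  also have "\<dots> \<le> 4 * sqrt (real T * ln (real T))"
  proof (rule mult_right_mono)
    \<comment> \<open>3/2 is below 16/9, which rounds the constant up to 4.\<close>
    have "sqrt (3 / 2) \<le> (4 / 3 :: real)" by (rule real_le_lsqrt) (auto simp: power2_eq_square)
    then show "3 * sqrt (3 / 2) \<le> (4::real)" by simp
  qed (use lb in simp)
  finally show ?thesis .
qed

text \<open>Of the 26, a share of 2 comes from the step sizes and 24 from the squared widths. The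
  latter sum to order \<open>ln T\<close> only, since over purchases they behave like the convergent
  series of \<open>n\<close> to the power -3/2.\<close>

lemma multiplier_regret:
  assumes "1 \<le> ln (real T)" "0 \<le> l0" "l0 \<le> lam_max"
  shows "(\<Sum>j\<in>{1..<T}. of_bool (live v p j) * ((mult v p j - l0) * (\<rho> - of_bool (sel v p j) * ct v p j)))
     \<le> (vbar / 2 * lam_max\<^sup>2 + 26 * vbar) * sqrt (real T * ln (real T))"
proof -
  note lb = log_bounds[OF assms(1)]
  define S where "S = sqrt (real T * ln (real T))"
  define L where "L = (ln 2 + 2 * ln (real T)) / 2"
  have L0: "0 \<le> L" using assms by (simp add: L_def)
  have "(\<Sum>j\<in>{1..<T}. of_bool (live v p j) * ((mult v p j - l0) * (\<rho> - of_bool (sel v p j) * ct v p j)))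
    \<le> (\<Sum>j\<in>{1..<T}. vbar / 2 * (sqrt (real (Suc j)) * ((mult v p j - l0)\<^sup>2 - (mult v p (Suc j) - l0)\<^sup>2))
       + vbar * (1 / sqrt (real (Suc j)))
       + 4 * vbar * (of_bool (sel v p j) * ((eps v p j)\<^sup>2 * (1 / sqrt (real (Suc j))))))"
  proof (rule sum_mono)
    fix j assume "j \<in> {1..<T}"
    then show "of_bool (live v p j) * ((mult v p j - l0) * (\<rho> - of_bool (sel v p j) * ct v p j)) \<le>
      vbar / 2 * (sqrt (real (Suc j)) * ((mult v p j - l0)\<^sup>2 - (mult v p (Suc j) - l0)\<^sup>2))
       + vbar * (1 / sqrt (real (Suc j)))
       + 4 * vbar * (of_bool (sel v p j) * ((eps v p j)\<^sup>2 * (1 / sqrt (real (Suc j)))))"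
      using ogd_step[of j l0] assms(2) by (simp add: mult_ac)
  qed
  also have "\<dots> = vbar / 2 * (\<Sum>j\<in>{1..<T}. sqrt (real (Suc j)) * ((mult v p j - l0)\<^sup>2 - (mult v p (Suc j) - l0)\<^sup>2))
       + vbar * (\<Sum>j\<in>{1..<T}. 1 / sqrt (real (Suc j)))
       + 4 * vbar * (\<Sum>j\<in>{1..<T}. of_bool (sel v p j) * ((eps v p j)\<^sup>2 * (1 / sqrt (real (Suc j)))))"
    by (simp only: sum.distrib sum_distrib_left)
  also have "\<dots> \<le> vbar / 2 * (lam_max\<^sup>2 * S) + vbar * (2 * S) + 4 * vbar * (6 * S)"
  proof (intro add_mono mult_left_mono)
    have "(\<Sum>j\<in>{1..<T}. sqrt (real (Suc j)) * ((mult v p j - l0)\<^sup>2 - (mult v p (Suc j) - l0)\<^sup>2))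
       \<le> sqrt (real T) * (lam_max\<^sup>2 - (mult v p T - l0)\<^sup>2)"
      using telescope[of T l0] assms lb(5) by simp
    also have "\<dots> \<le> sqrt (real T) * lam_max\<^sup>2" by (intro mult_left_mono) auto
    also have "\<dots> \<le> S * lam_max\<^sup>2" using lb(3) unfolding S_def by (intro mult_right_mono) auto
    finally show "(\<Sum>j\<in>{1..<T}. sqrt (real (Suc j)) * ((mult v p j - l0)\<^sup>2 - (mult v p (Suc j) - l0)\<^sup>2))
       \<le> lam_max\<^sup>2 * S" by (simp add: mult_ac)
    show "(\<Sum>j\<in>{1..<T}. 1 / sqrt (real (Suc j))) \<le> 2 * S"
      using sum_inverse_sqrt_le[of T] lb(3) unfolding S_def by linarith
    have "(\<Sum>j\<in>{1..<T}. of_bool (sel v p j) * ((eps v p j)\<^sup>2 * (1 / sqrt (real (Suc j)))))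
       \<le> (\<Sum>j\<in>{1..<T}. L * (of_bool (sel v p j) * (1 / (cnt v p j * sqrt (cnt v p j)))))"
    proof (rule sum_mono)
      fix j assume j: "j \<in> {1..<T}"
      have c: "1 \<le> cnt v p j" using cnt_ge_1 j by simp
      have e2: "(eps v p j)\<^sup>2 = L / cnt v p j"
        using L0 c unfolding eps_eq L_def[symmetric] by (simp add: power_divide)
      \<comment> \<open>There are at most as many samples as rounds, so the decay in time can be
        replaced by decay in the sample size.\<close>
      have "1 / sqrt (real (Suc j)) \<le> 1 / sqrt (cnt v p j)"
        using c cnt_le[of v p j] by (intro divide_left_mono) auto
      then have "(eps v p j)\<^sup>2 * (1 / sqrt (real (Suc j))) \<le> L / cnt v p j * (1 / sqrt (cnt v p j))"
        unfolding e2 using L0 c by (intro mult_left_mono) auto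
      also have "\<dots> = L * (1 / (cnt v p j * sqrt (cnt v p j)))" by simp
      finally show "of_bool (sel v p j) * ((eps v p j)\<^sup>2 * (1 / sqrt (real (Suc j))))
        \<le> L * (of_bool (sel v p j) * (1 / (cnt v p j * sqrt (cnt v p j))))" by simp
    qed
    also have "\<dots> \<le> L * (4 * (1 - 1 / sqrt (cnt v p T)))"
      unfolding sum_distrib_left[symmetric]
      using L0 sum_sel_inverse_sqrt(2) lb(5) by (intro mult_left_mono) auto
    also have "\<dots> \<le> L * 4" using L0 by (intro mult_left_mono) auto
    also have "\<dots> \<le> 6 * S" using lb(1,2) unfolding L_def S_def by linarith
    finally show "(\<Sum>j\<in>{1..<T}. of_bool (sel v p j) * ((eps v p j)\<^sup>2 * (1 / sqrt (real (Suc j))))) \<le> 6 * S" .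
  qed (use vbar_pos in auto)
  finally show ?thesis by (simp add: S_def algebra_simps)
qed

text \<open>With good estimates the first bound is optimism combined with the selection rule, and
  the factors 2 and 3 add the estimation error to the built-in bias of one or two widths. In a bad
  round \<open>vbar\<close> covers the loss; the purchase term in the first bound is nonnegative
  even then.\<close>

lemma round_bounds:
  fixes r c :: "real \<Rightarrow> real"
  assumes k: "1 \<le> k" "k < T" and "live v p k"
    and r: "r (v (Suc k)) \<in> {0..vbar}" and c: "c (v (Suc k)) \<in> {0..vbar}"
  defines "X \<equiv> of_bool (sel v p k) :: real" and "b \<equiv> of_bool (bad r c v p k) :: real"
  shows "max 0 (r (v (Suc k)) - mult v p k * c (v (Suc k))) \<le> X * (rt v p k - mult v p k * ct v p k) + vbar * b"
    and "X * rt v p k \<le> X * r (v (Suc k)) + 2 * vbar * (X * eps v p k) + vbar * b"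
    and "X * c (v (Suc k)) \<le> X * ct v p k + 3 * vbar * (X * eps v p k) + vbar * b"
proof -
  define w where "w = v (Suc k)"
  define e where "e = eps v p k"
  define m where "m = mult v p k"
  have vk: "0 \<le> w" "w \<le> vbar" using v_range[of "Suc k"] k by (auto simp: w_def)
  have e0: "0 \<le> e" using eps_nonneg k by (simp add: e_def)
  have ev: "0 \<le> e * w" "e * w \<le> vbar * e" using e0 vk by (auto simp: mult_ac intro: mult_left_mono)
  have m0: "0 \<le> m" using mult_nonneg by (simp add: m_def)
  define rh where "rh = rhat k"
  define ch where "ch = chat k"
  have hb: "0 \<le> rh" "rh \<le> w" "0 \<le> ch" "ch \<le> w"
    using hat_bounds[OF k] by (auto simp: w_def rh_def ch_def)
  have r': "0 \<le> r w" "r w \<le> vbar" and c': "0 \<le> c w" "c w \<le> vbar" using r c by (auto simp: w_def)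
  have good: "\<bar>rh - r w\<bar> \<le> e * w" "\<bar>ch - c w\<bar> \<le> e * w" if "b = 0"
    using that unfolding b_def bad_def w_def e_def rh_def ch_def by auto
  have selD: "m * ct v p k \<le> rt v p k" if "sel v p k" using that k by (simp add: sel_def m_def)
  have notsel: "rt v p k < m * ct v p k" if "\<not> sel v p k"
    using that k assms(3) by (auto simp: sel_def m_def)
  have X01: "X = 0 \<and> \<not> sel v p k \<or> X = 1 \<and> sel v p k" by (auto simp: X_def)
  have b01: "b = 0 \<or> b = 1" by (auto simp: b_def)
  have rt: "rt v p k = rh + e * w" and ct: "ct v p k = ch - 2 * (e * w)"
    by (auto simp: rt_eq ct_eq w_def e_def rh_def ch_def)
  have "max 0 (r w - m * c w) \<le> X * (rt v p k - m * ct v p k) + vbar * b"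
  proof (cases "b = 0")
    case True
    have "r w \<le> rt v p k" using good[OF True] unfolding rt by linarith
    moreover have "m * ct v p k \<le> m * c w"
      using good[OF True] m0 ev unfolding ct by (intro mult_left_mono) linarith+
    ultimately show ?thesis using X01 selD notsel True by fastforce
  next
    case False
    then have "b = 1" using b01 by simp
    have "max 0 (r w - m * c w) \<le> vbar" using r' vbar_pos mult_nonneg_nonneg[OF m0 c'(1)] by linarith
    moreover have "0 \<le> X * (rt v p k - m * ct v p k)" using X01 selD by auto
    ultimately show ?thesis using \<open>b = 1\<close> by simp
  qed
  then show "max 0 (r (v (Suc k)) - mult v p k * c (v (Suc k))) \<le> X * (rt v p k - mult v p k * ct v p k) + vbar * b"
    by (simp add: w_def m_def)
  have "rt v p k \<le> r w + 2 * vbar * e + vbar * b"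
  proof (cases "b = 0")
    case True
    then show ?thesis using good[OF True] ev unfolding rt by auto
  next
    case False
    then have "b = 1" using b01 by simp
    then show ?thesis using ev hb vk r' unfolding rt by simp
  qed
  then show "X * rt v p k \<le> X * r (v (Suc k)) + 2 * vbar * (X * eps v p k) + vbar * b"
    using X01 b01 vbar_pos by (auto simp: w_def e_def)
  have "c w \<le> ct v p k + 3 * vbar * e + vbar * b"
  proof (cases "b = 0")
    case True
    then show ?thesis using good[OF True] ev unfolding ct by auto
  next
    case False
    then have "b = 1" using b01 by simp
    then show ?thesis using ev hb vk c' unfolding ct by simp
  qed
  then show "X * c (v (Suc k)) \<le> X * ct v p k + 3 * vbar * (X * eps v p k) + vbar * b"
    using X01 b01 vbar_pos by (auto simp: w_def e_def)
qed

text \<open>All randomness is confined to three deviation hypotheses and the count of bad rounds.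
  Weak duality is used in each live round at the current multiplier, and the sum is compared with a
  fixed multiplier \<open>l0\<close> chosen at the end.\<close>

lemma regret_bound:
  fixes r c \<phi> :: "real \<Rightarrow> real" and opt :: real
  assumes lnT: "1 \<le> ln (real T)"
    and r: "\<And>w. w \<in> {0..vbar} \<Longrightarrow> r w \<in> {0..vbar}" and c: "\<And>w. w \<in> {0..vbar} \<Longrightarrow> c w \<in> {0..vbar}"
    and dual: "\<And>l. 0 \<le> l \<Longrightarrow> opt \<le> \<phi> l + l * \<rho>" and opt: "opt \<le> vbar"
  defines "S \<equiv> sqrt (real T * ln (real T))"
  assumes dev1: "(\<Sum>k<T. of_bool (live v p k) *
      (\<phi> (mult v p k) - max 0 (r (v (Suc k)) - mult v p k * c (v (Suc k))))) \<le> vbar * S"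
    and dev2: "(\<Sum>k<T. of_bool (sel v p k) * (r (v (Suc k)) - rew (v (Suc k)) (p (Suc k)))) \<le> vbar * S"
    and dev3: "(\<Sum>k<T. of_bool (sel v p k) * (cost (v (Suc k)) (p (Suc k)) - c (v (Suc k)))) \<le> vbar * S"
    and few_bad: "(\<Sum>k\<in>{1..<T}. of_bool (bad r c v p k)) \<le> 15 * sqrt (real T)"
  shows "real T * opt - rev v p T \<le> regret_const * S"
proof -
  note lb = log_bounds[OF lnT, folded S_def]
  define q where "q = vbar / \<rho>"
  have q0: "0 < q" using vbar_pos rho_pos by (simp add: q_def)
  define N where "N = (\<Sum>k<T. of_bool (live v p k) :: real)"
  define Xr where "Xr = (\<Sum>k\<in>{1..<T}. of_bool (sel v p k) * r (v (Suc k)))"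
  define Xc where "Xc = (\<Sum>k\<in>{1..<T}. of_bool (sel v p k) * c (v (Suc k)))"
  define E where "E = (\<Sum>k\<in>{1..<T}. of_bool (sel v p k) * eps v p k)"
  define Bd where "Bd = (\<Sum>k\<in>{1..<T}. of_bool (bad r c v p k) :: real)"
  define N1 where "N1 = (\<Sum>k\<in>{1..<T}. of_bool (live v p k) :: real)"
  define K where "K = (\<Sum>k<T. of_bool (sel v p k) * cost (v (Suc k)) (p (Suc k)))"
  have split0: "(\<Sum>k<T. g k) = g 0 + (\<Sum>k\<in>{1..<T}. g k)" for g :: "nat \<Rightarrow> real"
  proof -
    have "{..<T} = insert 0 {1..<T}" using lb(5) by auto
    then show ?thesis by simp
  qed
  have v1: "v (Suc 0) \<in> {0..vbar}" using v_range[of "Suc 0"] lb(5) by simp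
  note r1 = r[OF v1] and c1 = c[OF v1]
  have E4: "E \<le> 4 * S" unfolding E_def S_def by (rule sum_sel_eps_le[OF lnT])
  have Bd15: "Bd \<le> 15 * S" using few_bad lb(3) unfolding Bd_def by simp
  have Bd0: "0 \<le> Bd" unfolding Bd_def by (intro sum_nonneg) auto
  have E0: "0 \<le> E" unfolding E_def using eps_nonneg lb(5) by (intro sum_nonneg) auto
  have N1_le: "N1 \<le> N" unfolding N_def N1_def split0 by simp
  have Xr_le: "Xr \<le> rev v p T + vbar * S"
    using dev2 r1 unfolding Xr_def rev_eq by (simp add: split0 right_diff_distrib sum_subtractf sel_0)
  have Xc_ge: "K - vbar * S - vbar \<le> Xc"
    using dev3 c1 unfolding Xc_def K_def by (simp add: split0 right_diff_distrib sum_subtractf sel_0)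
  have main: "opt * N \<le> rev v p T + (2 * vbar * S + vbar) + (2 * vbar + 3 * vbar * l0) * (4 * S)
       + (2 * vbar + l0 * vbar) * (15 * S) + (vbar / 2 * lam_max\<^sup>2 + 26 * vbar) * S
       + l0 * (\<rho> * N - K + vbar * S + vbar)"
    if l0: "0 \<le> l0" "l0 \<le> lam_max" for l0
  proof -
    let ?a = "\<lambda>k. of_bool (live v p k) :: real"
    let ?X = "\<lambda>k. of_bool (sel v p k) :: real"
    let ?f = "\<lambda>k. max 0 (r (v (Suc k)) - mult v p k * c (v (Suc k)))"
    have "opt * N = (\<Sum>k<T. ?a k * opt)" by (simp add: N_def sum_distrib_left mult_ac)
    also have "\<dots> \<le> (\<Sum>k<T. ?a k * (\<phi> (mult v p k) - ?f k) + ?a k * (?f k + mult v p k * \<rho>))"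
    proof (rule sum_mono)
      fix k
      show "?a k * opt \<le> ?a k * (\<phi> (mult v p k) - ?f k) + ?a k * (?f k + mult v p k * \<rho>)"
        using dual[OF mult_nonneg[of v p k]] by (cases "live v p k") auto
    qed
    also have "\<dots> \<le> vbar * S + (\<Sum>k<T. ?a k * (?f k + mult v p k * \<rho>))"
      using dev1 by (simp only: sum.distrib)
    \<comment> \<open>The first round has no estimates; its multiplier is 0, so it contributes at
      most \<open>vbar\<close>.\<close>
    also have "(\<Sum>k<T. ?a k * (?f k + mult v p k * \<rho>)) \<le>
        vbar + (\<Sum>k\<in>{1..<T}. ?a k * (?f k + mult v p k * \<rho>))"
      unfolding split0 using r1 vbar_pos by (simp add: state_0)
    \<comment> \<open>The multiplier is split as its difference to \<open>l0\<close> plus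
      \<open>l0\<close>. The difference keeps the estimated cost seen by gradient descent, while the
      \<open>l0\<close> part is rewritten with the true cost so that it can be matched with the
      spending.\<close>
    also have "(\<Sum>k\<in>{1..<T}. ?a k * (?f k + mult v p k * \<rho>)) \<le>
       (\<Sum>k\<in>{1..<T}. ?X k * r (v (Suc k)) + (2 * vbar + 3 * vbar * l0) * (?X k * eps v p k)
          + (2 * vbar + l0 * vbar) * of_bool (bad r c v p k)
          + ?a k * ((mult v p k - l0) * (\<rho> - ?X k * ct v p k))
          + l0 * (\<rho> * ?a k - ?X k * c (v (Suc k))))"
    proof (rule sum_mono)
      fix k assume k: "k \<in> {1..<T}"
      show "?a k * (?f k + mult v p k * \<rho>) \<le> ?X k * r (v (Suc k)) + (2 * vbar + 3 * vbar * l0) * (?X k * eps v p k)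
          + (2 * vbar + l0 * vbar) * of_bool (bad r c v p k)
          + ?a k * ((mult v p k - l0) * (\<rho> - ?X k * ct v p k))
          + l0 * (\<rho> * ?a k - ?X k * c (v (Suc k)))"
      proof (cases "live v p k")
        case False
        then have "\<not> sel v p k" by (simp add: sel_def)
        then show ?thesis using False l0 vbar_pos by simp
      next
        case True
        have k': "1 \<le> k" "k < T" using k by auto
        have vk: "v (Suc k) \<in> {0..vbar}" using v_range[of "Suc k"] k by simp
        note rb = round_bounds[of k r c, OF k' True r[OF vk] c[OF vk]]
        have "l0 * (?X k * c (v (Suc k))) \<le> l0 * (?X k * ct v p k + 3 * vbar * (?X k * eps v p k) + vbar * of_bool (bad r c v p k))"
          by (rule mult_left_mono[OF rb(3) l0(1)])
        then show ?thesis using rb(1,2) True by (simp add: algebra_simps)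
      qed
    qed
    also have "\<dots> = Xr + (2 * vbar + 3 * vbar * l0) * E + (2 * vbar + l0 * vbar) * Bd
         + (\<Sum>k\<in>{1..<T}. ?a k * ((mult v p k - l0) * (\<rho> - ?X k * ct v p k)))
         + l0 * (\<rho> * N1 - Xc)"
      unfolding Xr_def E_def Bd_def N1_def Xc_def
      by (simp only: sum.distrib sum_distrib_left sum_subtractf right_diff_distrib)
    also have "\<dots> \<le> (rev v p T + vbar * S) + (2 * vbar + 3 * vbar * l0) * (4 * S) + (2 * vbar + l0 * vbar) * (15 * S)
         + (vbar / 2 * lam_max\<^sup>2 + 26 * vbar) * S + l0 * (\<rho> * N - (K - vbar * S - vbar))"
      using Xr_le E4 Bd15 multiplier_regret[OF lnT l0, folded S_def] N1_le Xc_ge l0 vbar_pos rho_pos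
      by (intro add_mono mult_left_mono diff_mono) auto
    finally show ?thesis by (simp add: algebra_simps)
  qed
  have Sv: "vbar \<le> vbar * S" using lb(4) vbar_pos by simp
  have qvS: "0 \<le> q * (vbar * S)" "q * vbar \<le> q * (vbar * S)"
    using q0 vbar_pos Sv lb(4) by (auto intro!: mult_left_mono)
  have RC: "regret_const * S = 67 * (vbar * S) + 30 * (q * (vbar * S)) + vbar / 2 * lam_max\<^sup>2 * S"
    unfolding regret_const_def q_def by (simp add: algebra_simps)
  have NT: "N \<le> real T" unfolding N_def using sum_bounded_above[of "{..<T}" "\<lambda>k. of_bool (live v p k) :: real" 1] by simp
  show ?thesis
  proof (cases "live v p T")
    case True
    have "N = real T" unfolding N_def using live_antimono[OF _ True] by simp
    moreover have "0 \<le> lam_max" using vbar_pos rho_pos by (simp add: lam_max_def)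
    \<comment> \<open>Every round is live, and comparator 0 removes the budget term.\<close>
    ultimately have "real T * opt \<le> rev v p T + 66 * (vbar * S) + vbar + vbar / 2 * lam_max\<^sup>2 * S"
      using main[of 0] by (simp add: algebra_simps)
    then show ?thesis using Sv qvS unfolding RC by linarith
  next
    case False
    have ql: "q \<le> lam_max" using q0 by (simp add: lam_max_def q_def)
    \<comment> \<open>An early stop means that almost the whole budget was spent. Comparator
      \<open>vbar / \<rho>\<close> converts this into a credit of \<open>vbar\<close> per lost
      round, which covers \<open>opt\<close> in each of them.\<close>
    have "\<rho> * real T - vbar < K" using not_live_bud[OF False] unfolding bud_eq K_def by simp
    then have "q * (\<rho> * N - K + vbar * S + vbar) \<le> q * (\<rho> * N - (\<rho> * real T - vbar) + vbar * S + vbar)"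
      using q0 by (intro mult_left_mono) auto
    also have "\<dots> = vbar * (N - real T) + 2 * (q * vbar) + q * (vbar * S)"
      using rho_pos by (simp add: q_def field_simps)
    finally have 1: "q * (\<rho> * N - K + vbar * S + vbar) \<le> \<dots>" .
    have "opt * (real T - N) \<le> vbar * (real T - N)" using opt NT by (intro mult_right_mono) auto
    then have "real T * opt \<le> opt * N + vbar * (real T - N)" by (simp add: algebra_simps)
    then show ?thesis using main[OF less_imp_le[OF q0] ql] 1 Sv qvS unfolding RC
      by (simp add: algebra_simps)
  qed
qed

end

section \<open>Random prices and values\<close>

lemma borel_measurable_rew [measurable (raw)]:
  assumes [measurable]: "f \<in> borel_measurable M" "g \<in> borel_measurable M"
  shows "(\<lambda>x. rew (f x) (g x)) \<in> borel_measurable M"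
  unfolding rew_def by measurable

lemma borel_measurable_cost [measurable (raw)]:
  assumes [measurable]: "f \<in> borel_measurable M" "g \<in> borel_measurable M"
  shows "(\<lambda>x. cost (f x) (g x)) \<in> borel_measurable M"
  unfolding cost_def by measurable

text \<open>This and the next three lemmas treat the formulas of one round with arbitrary measurable
  functions as state variables, so that the recursion enters only through their hypotheses.\<close>

lemma measurable_linear_index:
  fixes f g e h :: "'a \<Rightarrow> real"
  assumes [measurable]: "f \<in> borel_measurable M" "g \<in> borel_measurable M"
    "e \<in> borel_measurable M" "h \<in> borel_measurable M"
  shows "(\<lambda>x. f x / g x + e x * h x) \<in> borel_measurable M"
    and "(\<lambda>x. f x / g x - 2 * e x * h x) \<in> borel_measurable M"
  by measurable

lemma pred_index_rule:
  fixes f g h :: "'a \<Rightarrow> real"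
  assumes [measurable]: "Measurable.pred M l" "f \<in> borel_measurable M"
    "g \<in> borel_measurable M" "h \<in> borel_measurable M"
  shows "Measurable.pred M (\<lambda>x. l x \<and> (b \<or> f x * g x \<le> h x))"
  by measurable

lemma measurable_multiplier_step:
  fixes f g :: "'a \<Rightarrow> real"
  assumes [measurable]: "Measurable.pred M l" "Measurable.pred M s"
    "f \<in> borel_measurable M" "g \<in> borel_measurable M"
  shows "(\<lambda>x. if l x \<and> b then max 0 (f x + c * (of_bool (s x) * g x - d)) else f x) \<in> borel_measurable M"
  by measurable

lemma pred_abs_deviation:
  fixes f f' g w e :: "'a \<Rightarrow> real" and r r' :: "real \<Rightarrow> real"
  assumes [measurable]: "f \<in> borel_measurable M" "f' \<in> borel_measurable M" "g \<in> borel_measurable M"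
    "e \<in> borel_measurable M" "w \<in> borel_measurable M" "r \<in> borel_measurable borel" "r' \<in> borel_measurable borel"
  shows "Measurable.pred M (\<lambda>x. \<not> (\<bar>f x / g x - r (w x)\<bar> \<le> e x * w x \<and> \<bar>f' x / g x - r' (w x)\<bar> \<le> e x * w x))"
  by measurable

lemma measurable_binary_compose:
  fixes h :: "real \<Rightarrow> real \<Rightarrow> real"
  assumes "case_prod h \<in> borel_measurable (borel \<Otimes>\<^sub>M borel)" "f \<in> borel_measurable M" "g \<in> borel_measurable M"
  shows "(\<lambda>z. h (f z) (g z)) \<in> borel_measurable M"
  using measurable_compose[OF measurable_Pair[OF assms(2,3)] assms(1)] by simp

text \<open>Using one tilting parameter for all \<open>4\<^sup>j \<le> n < 4\<^sup>j\<^sup>+\<^sup>1\<close> costs a factor \<open>8/9\<close> against Hoeffding's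
  optimal exponent \<open>2 a\<^sup>2\<close>; any factor above \<open>3/4\<close> would do for the count of bad rounds.\<close>

lemma dyadic_block_exponent:
  fixes n :: nat and a D :: real
  assumes "1 \<le> n" "0 \<le> a" "a * sqrt (real n) < \<bar>D\<bar>"
  obtains j :: nat and c :: real where "4 ^ j \<le> n" "c = 1 \<or> c = -1"
    "16 / 9 * a\<^sup>2 \<le> c * (8 * a / (3 * 2 ^ j)) * D - (8 * a / (3 * 2 ^ j))\<^sup>2 / 8 * real n"
proof -
  obtain j where j: "4 ^ j \<le> n" "n < 4 ^ (j + 1)"
    using ex_power_ivl1[of 4 n] assms by auto
  define c :: real where "c = (if 0 \<le> D then 1 else -1)"
  have cD: "c * D = \<bar>D\<bar>" by (simp add: c_def)
  define s where "s = 8 * a / (3 * 2 ^ j)"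
  \<comment> \<open>For \<open>a > 0\<close>, \<open>q\<close> is the ratio of \<open>s\<close> to
    the optimal parameter \<open>4 * a / sqrt n\<close>. The exponent is \<open>2 * a^2\<close>
    times \<open>1 - (1 - q)^2\<close>, and the block keeps \<open>q\<close> within 1/3 of
    1.\<close>
  define q where "q = 2 / 3 * sqrt (real n) / 2 ^ j"
  have s0: "0 \<le> s" using assms by (simp add: s_def)
  have four: "((2::real) ^ j)\<^sup>2 = real (4 ^ j)"
    by (simp add: power2_eq_square flip: power_mult_distrib)
  have lo: "2 ^ j \<le> sqrt (real n)"
    by (rule real_le_rsqrt) (use j(1) in \<open>simp only: four of_nat_le_iff\<close>)
  have hi: "sqrt (real n) \<le> 2 * 2 ^ j"
  proof (rule real_le_lsqrt)
    have "real n \<le> real (4 * 4 ^ j)" using j(2) by (intro of_nat_mono) simp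
    then show "real n \<le> (2 * 2 ^ j)\<^sup>2" by (simp add: power_mult_distrib four)
  qed simp_all
  have q: "2 / 3 \<le> q" "q \<le> 4 / 3" using lo hi by (auto simp: q_def field_simps)
  have sa: "s * (a * sqrt (real n)) = 4 * a\<^sup>2 * q"
    by (simp add: s_def q_def power2_eq_square)
  have sn: "s\<^sup>2 / 8 * real n = 2 * a\<^sup>2 * q\<^sup>2"
    by (simp add: s_def q_def power_mult_distrib power_divide)
  have "\<bar>1 - q\<bar> \<le> \<bar>1 / 3\<bar>" using q by linarith
  then have "(1 - q)\<^sup>2 \<le> (1 / 3)\<^sup>2" by (rule abs_le_square_iff[THEN iffD1])
  then have "16 / 9 \<le> 4 * q - 2 * q\<^sup>2" by (simp add: power2_eq_square algebra_simps)
  then have "16 / 9 * a\<^sup>2 \<le> (4 * q - 2 * q\<^sup>2) * a\<^sup>2" by (rule mult_right_mono) simp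
  also have "\<dots> = s * (a * sqrt (real n)) - s\<^sup>2 / 8 * real n"
    unfolding sa sn by (simp add: algebra_simps)
  also have "\<dots> \<le> s * \<bar>D\<bar> - s\<^sup>2 / 8 * real n"
    using assms s0 by (intro diff_right_mono mult_left_mono) auto
  also have "\<dots> = c * s * D - s\<^sup>2 / 8 * real n" using cD by (simp add: mult_ac)
  finally show ?thesis using that[OF j(1), of c] by (simp add: s_def c_def)
qed

context ogd
begin

lemma state_cong:
  assumes "\<And>t. 1 \<le> t \<Longrightarrow> t \<le> k \<Longrightarrow> v t = v' t \<and> p t = p' t"
  shows "obs v p k = obs v' p' k \<and> bud v p k = bud v' p' k \<and> mult v p k = mult v' p' k
     \<and> live v p k = live v' p' k"
  using assms
proof (induction k)
  case (Suc k)
  then have IH: "obs v p k = obs v' p' k" "bud v p k = bud v' p' k" "mult v p k = mult v' p' k"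
     "live v p k = live v' p' k" by auto
  have vk: "v (Suc k) = v' (Suc k)" "p (Suc k) = p' (Suc k)" using Suc.prems by auto
  have "p \<tau> = p' \<tau>" if "\<tau> \<in> obs v' p' k" for \<tau>
    using Suc.prems[of \<tau>] obs_subset[of v' p' k] that by auto
  then have "rt v p k = rt v' p' k" "ct v p k = ct v' p' k"
    by (simp_all add: ogd_rt_def ogd_ct_def IH vk)
  then show ?case by (simp add: state_Suc sel_def IH vk state_0)
qed (simp add: state_0)

text \<open>The decision in round \<open>Suc k\<close> sees the value of that round but not its
  price. This predictability makes the purchased payoffs a martingale after centering.\<close>

lemma sel_cong:
  assumes "\<And>t. 1 \<le> t \<Longrightarrow> t \<le> k \<Longrightarrow> v t = v' t \<and> p t = p' t" and "v (Suc k) = v' (Suc k)"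
  shows "sel v p k = sel v' p' k"
proof -
  have eq: "obs v p k = obs v' p' k" "mult v p k = mult v' p' k" "live v p k = live v' p' k"
    using state_cong[of k v v' p p'] assms(1) by auto
  have "p \<tau> = p' \<tau>" if "\<tau> \<in> obs v' p' k" for \<tau>
    using assms(1)[of \<tau>] obs_subset[of v' p' k] that by auto
  then show ?thesis
    by (simp add: sel_def ogd_rt_def ogd_ct_def eq assms(2))
qed

end

section \<open>Independent rounds and measurability of the run\<close>

locale ogd_stoch = ogd +
  fixes F G :: "real measure"
  assumes F: "dist_on vbar F" and G: "dist_on vbar G"
begin

sublocale F: prob_space F using F by (simp add: dist_on_def)
sublocale G: prob_space G using G by (simp add: dist_on_def)
sublocale N: pair_prob_space F G by unfold_locales

lemma sets_F [measurable_cong]: "sets F = sets borel" and sets_G [measurable_cong]: "sets G = sets borel"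
  using F G by (auto simp: dist_on_def)

lemma AE_F: "AE w in F. w \<in> {0..vbar}" and AE_G: "AE q in G. q \<in> {0..vbar}"
  using F G by (auto simp: dist_on_def)

abbreviation P where "P (n :: nat) \<equiv> PiM {1..n} (\<lambda>_. F \<Otimes>\<^sub>M G)"
abbreviation vs :: "(nat \<Rightarrow> real \<times> real) \<Rightarrow> nat \<Rightarrow> real" where "vs \<omega> \<equiv> (\<lambda>t. fst (\<omega> t))"
abbreviation ps :: "(nat \<Rightarrow> real \<times> real) \<Rightarrow> nat \<Rightarrow> real" where "ps \<omega> \<equiv> (\<lambda>t. snd (\<omega> t))"

sublocale Pn: prob_space "P n" for n
  by (intro prob_space_PiM N.prob_space_axioms)

lemma measurable_vs: "i \<in> {1..n} \<Longrightarrow> (\<lambda>\<omega>. fst (\<omega> i)) \<in> borel_measurable (P n)"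
  and measurable_ps: "i \<in> {1..n} \<Longrightarrow> (\<lambda>\<omega>. snd (\<omega> i)) \<in> borel_measurable (P n)"
proof -
  assume i: "i \<in> {1..n}"
  have c: "(\<lambda>\<omega>. \<omega> i) \<in> measurable (P n) (F \<Otimes>\<^sub>M G)" by (rule measurable_component_singleton[OF i])
  have "fst \<in> borel_measurable (F \<Otimes>\<^sub>M G)" "snd \<in> borel_measurable (F \<Otimes>\<^sub>M G)" by measurable
  then show "(\<lambda>\<omega>. fst (\<omega> i)) \<in> borel_measurable (P n)" "(\<lambda>\<omega>. snd (\<omega> i)) \<in> borel_measurable (P n)"
    using c by (auto intro: measurable_compose)
qed

text \<open>All earlier decisions are carried through the induction because by
  \<open>sum_obs\<close> the estimates are sums over them.\<close>

lemma measurable_state_aux: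
  assumes "k \<le> n"
  shows "(\<forall>j<k. Measurable.pred (P n) (\<lambda>\<omega>. sel (vs \<omega>) (ps \<omega>) j)) \<and>
     (\<lambda>\<omega>. mult (vs \<omega>) (ps \<omega>) k) \<in> borel_measurable (P n) \<and>
     (\<lambda>\<omega>. bud (vs \<omega>) (ps \<omega>) k) \<in> borel_measurable (P n) \<and>
     Measurable.pred (P n) (\<lambda>\<omega>. live (vs \<omega>) (ps \<omega>) k)"
  using assms
proof (induction k)
  case 0
  then show ?case by (simp add: state_0)
next
  case (Suc k)
  then have IH: "\<And>j. j < k \<Longrightarrow> Measurable.pred (P n) (\<lambda>\<omega>. sel (vs \<omega>) (ps \<omega>) j)"
    and mm: "(\<lambda>\<omega>. mult (vs \<omega>) (ps \<omega>) k) \<in> borel_measurable (P n)"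
    and bm [measurable]: "(\<lambda>\<omega>. bud (vs \<omega>) (ps \<omega>) k) \<in> borel_measurable (P n)"
    and lm: "Measurable.pred (P n) (\<lambda>\<omega>. live (vs \<omega>) (ps \<omega>) k)" by auto
  have pm: "(\<lambda>\<omega>. snd (\<omega> (Suc j))) \<in> borel_measurable (P n)" if "j < Suc k" for j
    using that Suc.prems by (intro measurable_ps) auto
  have vm [measurable]: "(\<lambda>\<omega>. fst (\<omega> (Suc k))) \<in> borel_measurable (P n)"
    using Suc.prems by (intro measurable_vs) auto
  have [measurable]: "(\<lambda>\<omega>. snd (\<omega> (Suc k))) \<in> borel_measurable (P n)" by (rule pm) simp
  have cm: "(\<lambda>\<omega>. real (card (obs (vs \<omega>) (ps \<omega>) k))) \<in> borel_measurable (P n)"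
    unfolding cnt_eq by (intro borel_measurable_sum) (use IH in measurable)
  have s1: "(\<lambda>\<omega>. \<Sum>\<tau>\<in>obs (vs \<omega>) (ps \<omega>) k. rew (fst (\<omega> (Suc k))) (snd (\<omega> \<tau>))) \<in> borel_measurable (P n)"
    unfolding sum_obs
  proof (intro borel_measurable_sum)
    fix j assume "j \<in> {..<k}"
    then have [measurable]: "Measurable.pred (P n) (\<lambda>\<omega>. sel (vs \<omega>) (ps \<omega>) j)"
      "(\<lambda>\<omega>. snd (\<omega> (Suc j))) \<in> borel_measurable (P n)" using IH pm by auto
    show "(\<lambda>\<omega>. of_bool (sel (vs \<omega>) (ps \<omega>) j) * rew (fst (\<omega> (Suc k))) (snd (\<omega> (Suc j)))) \<in> borel_measurable (P n)"
      by measurable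
  qed
  have s2: "(\<lambda>\<omega>. \<Sum>\<tau>\<in>obs (vs \<omega>) (ps \<omega>) k. cost (fst (\<omega> (Suc k))) (snd (\<omega> \<tau>))) \<in> borel_measurable (P n)"
    unfolding sum_obs
  proof (intro borel_measurable_sum)
    fix j assume "j \<in> {..<k}"
    then have [measurable]: "Measurable.pred (P n) (\<lambda>\<omega>. sel (vs \<omega>) (ps \<omega>) j)"
      "(\<lambda>\<omega>. snd (\<omega> (Suc j))) \<in> borel_measurable (P n)" using IH pm by auto
    show "(\<lambda>\<omega>. of_bool (sel (vs \<omega>) (ps \<omega>) j) * cost (fst (\<omega> (Suc k))) (snd (\<omega> (Suc j)))) \<in> borel_measurable (P n)"
      by measurable
  qed
  have em: "(\<lambda>\<omega>. eps (vs \<omega>) (ps \<omega>) k) \<in> borel_measurable (P n)"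
    unfolding eps_eq
    by (intro borel_measurable_divide borel_measurable_const measurable_compose[OF cm borel_measurable_sqrt])
  have rm: "(\<lambda>\<omega>. rt (vs \<omega>) (ps \<omega>) k) \<in> borel_measurable (P n)"
    unfolding ogd_rt_def by (rule measurable_linear_index(1)[OF s1 cm em vm])
  have tm: "(\<lambda>\<omega>. ct (vs \<omega>) (ps \<omega>) k) \<in> borel_measurable (P n)"
    unfolding ogd_ct_def by (rule measurable_linear_index(2)[OF s2 cm em vm])
  have sk [measurable]: "Measurable.pred (P n) (\<lambda>\<omega>. sel (vs \<omega>) (ps \<omega>) k)"
    unfolding sel_def by (rule pred_index_rule[OF lm mm tm rm])
  have b [measurable]: "(\<lambda>\<omega>. bud (vs \<omega>) (ps \<omega>) (Suc k)) \<in> borel_measurable (P n)"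
    unfolding state_Suc(2) by measurable
  have "(\<lambda>\<omega>. mult (vs \<omega>) (ps \<omega>) (Suc k)) \<in> borel_measurable (P n)"
    unfolding state_Suc(3) by (rule measurable_multiplier_step[OF lm sk mm tm])
  moreover have "Measurable.pred (P n) (\<lambda>\<omega>. live (vs \<omega>) (ps \<omega>) (Suc k))"
    unfolding state_Suc(4) using lm by measurable
  ultimately show ?case using b sk IH by (auto simp: less_Suc_eq)
qed

lemma measurable_state:
  "k < n \<Longrightarrow> Measurable.pred (P n) (\<lambda>\<omega>. sel (vs \<omega>) (ps \<omega>) k)"
  "k \<le> n \<Longrightarrow> (\<lambda>\<omega>. mult (vs \<omega>) (ps \<omega>) k) \<in> borel_measurable (P n)"
  "k \<le> n \<Longrightarrow> Measurable.pred (P n) (\<lambda>\<omega>. live (vs \<omega>) (ps \<omega>) k)"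
  using measurable_state_aux[of n n] measurable_state_aux[of k n] by auto

lemma measurable_rev: "(\<lambda>\<omega>. rev (vs \<omega>) (ps \<omega>) n) \<in> borel_measurable (P n)"
  unfolding rev_eq
proof (intro borel_measurable_sum)
  fix j assume j: "j \<in> {..<n}"
  have [measurable]: "Measurable.pred (P n) (\<lambda>\<omega>. sel (vs \<omega>) (ps \<omega>) j)"
    using j by (intro measurable_state) auto
  have [measurable]: "(\<lambda>\<omega>. fst (\<omega> (Suc j))) \<in> borel_measurable (P n)" "(\<lambda>\<omega>. snd (\<omega> (Suc j))) \<in> borel_measurable (P n)"
    using j by (auto intro!: measurable_vs measurable_ps)
  show "(\<lambda>\<omega>. of_bool (sel (vs \<omega>) (ps \<omega>) j) * rew (fst (\<omega> (Suc j))) (snd (\<omega> (Suc j)))) \<in> borel_measurable (P n)"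
    by measurable
qed

section \<open>Expected payoffs and Lagrangian duality\<close>

definition er where "er w = (\<integral>q. rew w q \<partial>G)"
definition ec where "ec w = (\<integral>q. cost w q \<partial>G)"
text \<open>The Lagrangian dual function without its linear term \<open>l * \<rho>\<close>.\<close>

definition dual where "dual l = (\<integral>w. max 0 (er w - l * ec w) \<partial>F)"

lemma measurable_er [measurable]: "er \<in> borel_measurable borel"
  and measurable_ec [measurable]: "ec \<in> borel_measurable borel"
  unfolding er_def[abs_def] ec_def[abs_def] by measurable

lemma measurable_dual [measurable]: "dual \<in> borel_measurable borel"
  unfolding dual_def[abs_def] by measurable

lemma AE_rew: "0 \<le> w \<Longrightarrow> AE q in G. rew w q \<in> {0..w}"
  and AE_cost: "0 \<le> w \<Longrightarrow> AE q in G. cost w q \<in> {0..w}"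
proof -
  assume w: "0 \<le> w"
  show "AE q in G. rew w q \<in> {0..w}" using AE_G by eventually_elim (use w rew_bounds in auto)
  show "AE q in G. cost w q \<in> {0..w}" using AE_G by eventually_elim (use w cost_bounds in auto)
qed

lemma er_bounds: "0 \<le> w \<Longrightarrow> er w \<in> {0..w}"
  and ec_bounds: "0 \<le> w \<Longrightarrow> ec w \<in> {0..w}"
  unfolding er_def ec_def by (rule G.expectation_in_interval; use AE_rew AE_cost in simp)+

lemma AE_lagrangian:
  assumes "0 \<le> l"
  shows "AE w in F. max 0 (er w - l * ec w) \<in> {0..vbar}"
  using AE_F
proof eventually_elim
  case (elim w)
  then have "er w \<le> vbar" "0 \<le> l * ec w" using er_bounds[of w] ec_bounds[of w] assms by auto
  then show ?case using vbar_pos by simp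
qed

lemma AE_pair_range: "AE y in F \<Otimes>\<^sub>M G. fst y \<in> {0..vbar} \<and> snd y \<in> {0..vbar}"
proof -
  have "AE x in F. AE y in G. x \<in> {0..vbar} \<and> y \<in> {0..vbar}"
    using AE_F by eventually_elim (use AE_G in auto)
  then show ?thesis by (subst N.AE_pair_iff[symmetric]) auto
qed

text \<open>Fubini turns both integrals into integrals over the values. There
  \<open>\<pi> w * (er w - l * ec w)\<close> is at most the positive part, and feasibility pays for
  the remaining cost term.\<close>

lemma weak_duality:
  assumes [measurable]: "\<pi> \<in> borel_measurable borel" and \<pi>: "\<And>w. 0 \<le> \<pi> w \<and> \<pi> w \<le> 1"
    and feas: "(\<integral>vp. \<pi> (fst vp) * cost (fst vp) (snd vp) \<partial>(F \<Otimes>\<^sub>M G)) \<le> \<rho>" and "0 \<le> l"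
  shows "(\<integral>vp. \<pi> (fst vp) * rew (fst vp) (snd vp) \<partial>(F \<Otimes>\<^sub>M G)) \<le> dual l + l * \<rho>"
proof -
  have bnd: "x * y \<in> {0..vbar}" if "0 \<le> x \<and> x \<le> 1" "y \<in> {0..w}" "w \<in> {0..vbar}" for x y w :: real
    using that mult_left_le_one_le[of y x] by auto
  have AE1: "AE y in F \<Otimes>\<^sub>M G. \<pi> (fst y) * rew (fst y) (snd y) \<in> {0..vbar}"
    using AE_pair_range
  proof eventually_elim
    case (elim y)
    then show ?case by (intro bnd[OF \<pi>, of _ "fst y"] rew_bounds) auto
  qed
  have AE2: "AE y in F \<Otimes>\<^sub>M G. \<pi> (fst y) * cost (fst y) (snd y) \<in> {0..vbar}"
    using AE_pair_range
  proof eventually_elim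
    case (elim y)
    then show ?case by (intro bnd[OF \<pi>, of _ "fst y"] cost_bounds) auto
  qed
  have i1: "integrable (F \<Otimes>\<^sub>M G) (\<lambda>y. \<pi> (fst y) * rew (fst y) (snd y))"
    by (rule N.expectation_in_interval(1)[OF _ AE1]) measurable
  have i2: "integrable (F \<Otimes>\<^sub>M G) (\<lambda>y. \<pi> (fst y) * cost (fst y) (snd y))"
    by (rule N.expectation_in_interval(1)[OF _ AE2]) measurable
  have e1: "(\<integral>y. \<pi> (fst y) * rew (fst y) (snd y) \<partial>(F \<Otimes>\<^sub>M G)) = (\<integral>w. \<pi> w * er w \<partial>F)"
    using N.integral_fst'[OF i1] by (simp add: er_def)
  have e2: "(\<integral>y. \<pi> (fst y) * cost (fst y) (snd y) \<partial>(F \<Otimes>\<^sub>M G)) = (\<integral>w. \<pi> w * ec w \<partial>F)"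
    using N.integral_fst'[OF i2] by (simp add: ec_def)
  have j1: "integrable F (\<lambda>w. \<pi> w * er w)" using N.integrable_fst'[OF i1] by (simp add: er_def)
  have j2: "integrable F (\<lambda>w. \<pi> w * ec w)" using N.integrable_fst'[OF i2] by (simp add: ec_def)
  have j3: "integrable F (\<lambda>w. max 0 (er w - l * ec w))"
    by (rule F.expectation_in_interval(1)[OF _ AE_lagrangian[OF \<open>0 \<le> l\<close>]]) measurable
  have "(\<integral>w. \<pi> w * er w \<partial>F) \<le> (\<integral>w. max 0 (er w - l * ec w) + l * (\<pi> w * ec w) \<partial>F)"
  proof (rule integral_mono)
    fix w
    have "\<pi> w * (er w - l * ec w) \<le> \<pi> w * max 0 (er w - l * ec w)"
      using \<pi> by (intro mult_left_mono) auto
    also have "\<dots> \<le> max 0 (er w - l * ec w)"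
      using \<pi> by (intro mult_left_le_one_le) auto
    finally show "\<pi> w * er w \<le> max 0 (er w - l * ec w) + l * (\<pi> w * ec w)"
      by (simp add: algebra_simps)
  qed (use j1 j2 j3 in auto)
  also have "\<dots> = dual l + l * (\<integral>w. \<pi> w * ec w \<partial>F)"
    using j2 j3 by (simp add: dual_def)
  also have "\<dots> \<le> dual l + l * \<rho>"
    using feas \<open>0 \<le> l\<close> unfolding e2 by (intro add_left_mono mult_left_mono) auto
  finally show ?thesis unfolding e1 .
qed

text \<open>The zero policy makes the feasible set nonempty, so the real supremum inherits the dual
  bounds; \<open>l = 0\<close> gives the bound by \<open>vbar\<close>.\<close>

lemma OPT_dual:
  obtains opt where "OPT F G \<rho> T = real T * opt" "\<And>l. 0 \<le> l \<Longrightarrow> opt \<le> dual l + l * \<rho>" "opt \<le> vbar"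
proof
  let ?A = "{\<pi> \<in> borel_measurable borel. (\<forall>v. 0 \<le> \<pi> v \<and> \<pi> v \<le> 1) \<and>
                (\<integral>vp. \<pi> (fst vp) * cost (fst vp) (snd vp) \<partial>(F \<Otimes>\<^sub>M G)) \<le> \<rho>}"
  let ?opt = "SUP \<pi> \<in> ?A. \<integral>vp. \<pi> (fst vp) * rew (fst vp) (snd vp) \<partial>(F \<Otimes>\<^sub>M G)"
  have ne: "?A \<noteq> {}" using rho_pos by (auto intro!: exI[of _ "\<lambda>_. 0"])
  show "OPT F G \<rho> T = real T * ?opt" by (simp add: OPT_def)
  show d: "?opt \<le> dual l + l * \<rho>" if "0 \<le> l" for l
    by (rule cSUP_least[OF ne]) (use weak_duality that in auto)
  have "dual 0 \<le> vbar"
    using F.expectation_in_interval(2)[OF _ AE_lagrangian[of 0]] by (simp add: dual_def)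
  then show "?opt \<le> vbar" using d[of 0] by simp
qed

lemma space_F [simp]: "space F = UNIV" and space_G [simp]: "space G = UNIV"
  using sets_eq_imp_space_eq[OF sets_F] sets_eq_imp_space_eq[OF sets_G] by auto

lemma measurable_mean:
  fixes h :: "real \<Rightarrow> real \<Rightarrow> real"
  assumes "case_prod h \<in> borel_measurable (borel \<Otimes>\<^sub>M borel)"
  shows "(\<lambda>w. \<integral>q. h w q \<partial>G) \<in> borel_measurable (borel :: real measure)"
proof -
  have "sets (borel \<Otimes>\<^sub>M G) = sets (borel \<Otimes>\<^sub>M borel :: (real \<times> real) measure)"
    by (rule sets_pair_measure_cong) (auto simp: sets_G)
  then have "case_prod h \<in> borel_measurable (borel \<Otimes>\<^sub>M G)"
    using assms measurable_cong_sets by blast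
  from G.borel_measurable_lebesgue_integral[OF this] show ?thesis .
qed

section \<open>Martingale deviations of payoffs and Lagrangians\<close>

lemma state_upd:
  "k < i \<Longrightarrow> mult (vs (x(i := y))) (ps (x(i := y))) k = mult (vs x) (ps x) k"
  "k < i \<Longrightarrow> live (vs (x(i := y))) (ps (x(i := y))) k = live (vs x) (ps x) k"
  "k < i \<Longrightarrow> obs (vs (x(i := y))) (ps (x(i := y))) k = obs (vs x) (ps x) k"
  using state_cong[of k "vs (x(i := y))" "vs x" "ps (x(i := y))" "ps x"] by auto

lemma sel_upd: "Suc k < i \<Longrightarrow> sel (vs (x(i := y))) (ps (x(i := y))) k = sel (vs x) (ps x) k"
  by (rule sel_cong) auto

text \<open>The dummy price 0 exhibits the decision as a function of the value alone once the past
  is fixed.\<close>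

lemma sel_upd_snd:
  "sel (vs (x(Suc k := y))) (ps (x(Suc k := y))) k = sel (vs (x(Suc k := (fst y, 0)))) (ps (x(Suc k := (fst y, 0)))) k"
  by (rule sel_cong) auto

lemma measurable_upd:
  assumes "x \<in> space (P k)" "f \<in> measurable M (F \<Otimes>\<^sub>M G)"
  shows "(\<lambda>y. x(Suc k := f y)) \<in> measurable M (P (Suc k))"
  using assms by (intro measurable_fun_upd[where J="{1..k}"]) auto

text \<open>Given the past and the value, the decision is fixed and Hoeffding's lemma applies to the
  price. The compensator stands inside the indicator: rounds without a purchase cost nothing, which
  later yields bounds in terms of the sample size instead of time.\<close>

lemma sel_mgf:
  fixes h :: "real \<Rightarrow> real \<Rightarrow> real"
  assumes x: "x \<in> space (P k)"
    and hm: "case_prod h \<in> borel_measurable (borel \<Otimes>\<^sub>M borel)"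
    and bnd: "\<And>w. w \<in> {0..vbar} \<Longrightarrow> AE q in G. h w q \<in> {0..b}"
  shows "(\<integral>\<^sup>+y. ennreal (exp (of_bool (sel (vs (x(Suc k := y))) (ps (x(Suc k := y))) k) *
     (s * (h (fst y) (snd y) - (\<integral>q. h (fst y) q \<partial>G)) - s\<^sup>2 * b\<^sup>2 / 8))) \<partial>(F \<Otimes>\<^sub>M G)) \<le> 1"
proof -
  define \<sigma> where "\<sigma> w = sel (vs (x(Suc k := (w, 0)))) (ps (x(Suc k := (w, 0)))) k" for w
  note measurable_binary_compose[OF hm, measurable (raw)]
  note measurable_mean[OF hm, measurable]
  have "(\<lambda>w. x(Suc k := (w, 0))) \<in> measurable F (P (Suc k))"
    by (rule measurable_upd[OF x]) measurable
  then have [measurable]: "Measurable.pred F \<sigma>"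
    unfolding \<sigma>_def[abs_def] by (rule measurable_compose[OF _ measurable_state(1)]) simp
  let ?d = "\<lambda>w q. of_bool (\<sigma> w) * (s * (h w q - (\<integral>q. h w q \<partial>G)) - s\<^sup>2 * b\<^sup>2 / 8)"
  have "(\<integral>\<^sup>+y. ennreal (exp (of_bool (sel (vs (x(Suc k := y))) (ps (x(Suc k := y))) k) *
     (s * (h (fst y) (snd y) - (\<integral>q. h (fst y) q \<partial>G)) - s\<^sup>2 * b\<^sup>2 / 8))) \<partial>(F \<Otimes>\<^sub>M G))
    = (\<integral>\<^sup>+y. ennreal (exp (?d (fst y) (snd y))) \<partial>(F \<Otimes>\<^sub>M G))"
    by (subst sel_upd_snd) (simp only: \<sigma>_def)
  also have "\<dots> = (\<integral>\<^sup>+w. \<integral>\<^sup>+q. ennreal (exp (?d w q)) \<partial>G \<partial>F)"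
    by (subst G.nn_integral_fst[symmetric]) (auto, measurable)
  also have "\<dots> \<le> (\<integral>\<^sup>+w. 1 \<partial>F)"
  proof (rule nn_integral_mono_AE, use AE_F in eventually_elim)
    fix w assume w: "w \<in> {0..vbar}"
    show "(\<integral>\<^sup>+q. ennreal (exp (?d w q)) \<partial>G) \<le> 1"
    proof (cases "\<sigma> w")
      case True
      have "h w \<in> borel_measurable G" by measurable
      from G.Hoeffding_mgf_le_1[OF this bnd[OF w]] True show ?thesis by simp
    next
      case False
      then show ?thesis using G.emeasure_space_1 by simp
    qed
  qed
  also have "\<dots> = 1" using F.emeasure_space_1 by simp
  finally show ?thesis .
qed

lemma measurable_sel_deviation:
  fixes h :: "real \<Rightarrow> real \<Rightarrow> real" and c :: real
  assumes hm: "case_prod h \<in> borel_measurable (borel \<Otimes>\<^sub>M borel)" and jk: "j < k"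
  shows "(\<lambda>\<omega>. c * (of_bool (sel (vs \<omega>) (ps \<omega>) j) *
     (h (fst (\<omega> (Suc j))) (snd (\<omega> (Suc j))) - (\<integral>q. h (fst (\<omega> (Suc j))) q \<partial>G)))) \<in> borel_measurable (P k)"
proof -
  have v: "(\<lambda>\<omega>. fst (\<omega> (Suc j))) \<in> borel_measurable (P k)" and p: "(\<lambda>\<omega>. snd (\<omega> (Suc j))) \<in> borel_measurable (P k)"
    using jk by (auto intro!: measurable_vs measurable_ps)
  have [measurable]: "(\<lambda>\<omega>. h (fst (\<omega> (Suc j))) (snd (\<omega> (Suc j)))) \<in> borel_measurable (P k)"
    by (rule measurable_binary_compose[OF hm v p])
  have [measurable]: "(\<lambda>\<omega>. \<integral>q. h (fst (\<omega> (Suc j))) q \<partial>G) \<in> borel_measurable (P k)"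
    by (rule measurable_compose[OF v measurable_mean[OF hm]])
  have [measurable]: "Measurable.pred (P k) (\<lambda>\<omega>. sel (vs \<omega>) (ps \<omega>) j)" by (rule measurable_state(1)[OF jk])
  show ?thesis
    by measurable
qed

lemma sel_deviation:
  fixes h :: "real \<Rightarrow> real \<Rightarrow> real"
  assumes hm: "case_prod h \<in> borel_measurable (borel \<Otimes>\<^sub>M borel)"
    and bnd: "\<And>w. w \<in> {0..vbar} \<Longrightarrow> AE q in G. h w q \<in> {0..vbar}"
    and c: "c = 1 \<or> c = (-1::real)" and "0 < n" "0 \<le> a"
  shows "measure (P n) {\<omega> \<in> space (P n). a < (\<Sum>k<n. c * (of_bool (sel (vs \<omega>) (ps \<omega>) k) *
     (h (fst (\<omega> (Suc k))) (snd (\<omega> (Suc k))) - (\<integral>q. h (fst (\<omega> (Suc k))) q \<partial>G))))}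
    \<le> exp (- 2 * a\<^sup>2 / (real n * vbar\<^sup>2))"
proof (rule N.Azuma_Hoeffding_PiM)
  fix j k assume "j < k" "k \<le> n"
  then show "(\<lambda>\<omega>. c * (of_bool (sel (vs \<omega>) (ps \<omega>) j) *
     (h (fst (\<omega> (Suc j))) (snd (\<omega> (Suc j))) - (\<integral>q. h (fst (\<omega> (Suc j))) q \<partial>G)))) \<in> borel_measurable (P k)"
    by (intro measurable_sel_deviation hm)
next
  fix k x s assume k: "k < n" and x: "x \<in> space (P k)"
  let ?X = "\<lambda>y. of_bool (sel (vs (x(Suc k := y))) (ps (x(Suc k := y))) k) :: real"
  let ?h = "\<lambda>y. h (fst y) (snd y) - (\<integral>q. h (fst y) q \<partial>G)"
  have c2: "(s * c)\<^sup>2 = s\<^sup>2" using c by auto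
  \<comment> \<open>For a bound in terms of \<open>n\<close> the compensator may be charged in every
    round, which only lowers the exponent.\<close>
  have "(\<integral>\<^sup>+y. ennreal (exp (s * (c * (?X y * ?h y)) - s\<^sup>2 * vbar\<^sup>2 / 8)) \<partial>(F \<Otimes>\<^sub>M G))
    \<le> (\<integral>\<^sup>+y. ennreal (exp (?X y * (s * c * ?h y - (s * c)\<^sup>2 * vbar\<^sup>2 / 8))) \<partial>(F \<Otimes>\<^sub>M G))"
    unfolding c2 by (intro nn_integral_mono ennreal_leI) (auto simp: mult_ac)
  also have "\<dots> \<le> 1" by (rule sel_mgf[OF x hm bnd])
  finally show "(\<integral>\<^sup>+y. ennreal (exp (s * (c * (of_bool (sel (vs (x(Suc k := y))) (ps (x(Suc k := y))) k) *
     (h (fst ((x(Suc k := y)) (Suc k))) (snd ((x(Suc k := y)) (Suc k))) -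
       (\<integral>q. h (fst ((x(Suc k := y)) (Suc k))) q \<partial>G)))) - s\<^sup>2 * vbar\<^sup>2 / 8)) \<partial>(F \<Otimes>\<^sub>M G)) \<le> 1"
    by simp
next
  fix j k :: nat and x :: "nat \<Rightarrow> real \<times> real" and y assume jk: "j < k" "k < n"
  then show "c * (of_bool (sel (vs (x(Suc k := y))) (ps (x(Suc k := y))) j) *
     (h (fst ((x(Suc k := y)) (Suc j))) (snd ((x(Suc k := y)) (Suc j))) -
       (\<integral>q. h (fst ((x(Suc k := y)) (Suc j))) q \<partial>G))) =
     c * (of_bool (sel (vs x) (ps x) j) * (h (fst (x (Suc j))) (snd (x (Suc j))) - (\<integral>q. h (fst (x (Suc j))) q \<partial>G)))"
    by (simp add: sel_upd fun_upd_other del: fun_upd_apply)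
qed (use assms vbar_pos in auto)

lemma measurable_lagrangian_deviation:
  assumes jk: "j < k"
  shows "(\<lambda>\<omega>. of_bool (live (vs \<omega>) (ps \<omega>) j) * (dual (mult (vs \<omega>) (ps \<omega>) j) -
      max 0 (er (fst (\<omega> (Suc j))) - mult (vs \<omega>) (ps \<omega>) j * ec (fst (\<omega> (Suc j)))))) \<in> borel_measurable (P k)"
proof -
  have [measurable]: "(\<lambda>\<omega>. fst (\<omega> (Suc j))) \<in> borel_measurable (P k)"
    using jk by (auto intro!: measurable_vs)
  have [measurable]: "Measurable.pred (P k) (\<lambda>\<omega>. live (vs \<omega>) (ps \<omega>) j)"
    "(\<lambda>\<omega>. mult (vs \<omega>) (ps \<omega>) j) \<in> borel_measurable (P k)"
    by (rule measurable_state(3)[OF less_imp_le[OF jk]]) (rule measurable_state(2)[OF less_imp_le[OF jk]])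
  show ?thesis by measurable
qed

text \<open>The multiplier and the stopping flag depend on earlier rounds only, so the new value is
  independent of them and \<open>dual\<close> at the current multiplier is the conditional
  mean.\<close>

lemma lagrangian_deviation:
  assumes "0 < n" "0 \<le> a"
  shows "measure (P n) {\<omega> \<in> space (P n). a < (\<Sum>k<n. of_bool (live (vs \<omega>) (ps \<omega>) k) *
     (dual (mult (vs \<omega>) (ps \<omega>) k) -
      max 0 (er (fst (\<omega> (Suc k))) - mult (vs \<omega>) (ps \<omega>) k * ec (fst (\<omega> (Suc k))))))}
    \<le> exp (- 2 * a\<^sup>2 / (real n * vbar\<^sup>2))"
proof (rule N.Azuma_Hoeffding_PiM)
  fix j k assume "j < k" "k \<le> n"
  then show "(\<lambda>\<omega>. of_bool (live (vs \<omega>) (ps \<omega>) j) * (dual (mult (vs \<omega>) (ps \<omega>) j) -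
      max 0 (er (fst (\<omega> (Suc j))) - mult (vs \<omega>) (ps \<omega>) j * ec (fst (\<omega> (Suc j)))))) \<in> borel_measurable (P k)"
    by (intro measurable_lagrangian_deviation)
next
  fix k x s assume k: "k < n" and x: "x \<in> space (P k)"
  let ?l = "mult (vs x) (ps x) k"
  let ?f = "\<lambda>w. max 0 (er w - ?l * ec w)"
  let ?a = "of_bool (live (vs x) (ps x) k) :: real"
  have "(\<integral>\<^sup>+y. ennreal (exp (s * (?a * (dual ?l - ?f (fst y))) - s\<^sup>2 * vbar\<^sup>2 / 8)) \<partial>(F \<Otimes>\<^sub>M G))
     = (\<integral>\<^sup>+w. \<integral>\<^sup>+q. ennreal (exp (s * (?a * (dual ?l - ?f w)) - s\<^sup>2 * vbar\<^sup>2 / 8)) \<partial>G \<partial>F)"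
    by (subst G.nn_integral_fst[symmetric]) (auto, measurable)
  also have "\<dots> = (\<integral>\<^sup>+w. ennreal (exp (s * (?a * (dual ?l - ?f w)) - s\<^sup>2 * vbar\<^sup>2 / 8)) \<partial>F)"
    using G.emeasure_space_1 by simp
  also have "\<dots> \<le> (\<integral>\<^sup>+w. ennreal (exp ((- s * ?a) * (?f w - dual ?l) - (- s * ?a)\<^sup>2 * vbar\<^sup>2 / 8)) \<partial>F)"
    by (intro nn_integral_mono ennreal_leI) (auto simp: algebra_simps)
  also have "\<dots> \<le> 1"
    unfolding dual_def
    by (rule F.Hoeffding_mgf_le_1[OF _ AE_lagrangian[OF mult_nonneg]]) measurable
  finally show "(\<integral>\<^sup>+y. ennreal (exp (s * (of_bool (live (vs (x(Suc k := y))) (ps (x(Suc k := y))) k) *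
     (dual (mult (vs (x(Suc k := y))) (ps (x(Suc k := y))) k) -
      max 0 (er (fst ((x(Suc k := y)) (Suc k))) - mult (vs (x(Suc k := y))) (ps (x(Suc k := y))) k *
        ec (fst ((x(Suc k := y)) (Suc k)))))) - s\<^sup>2 * vbar\<^sup>2 / 8)) \<partial>(F \<Otimes>\<^sub>M G)) \<le> 1"
    by (simp add: state_upd fun_upd_same del: fun_upd_apply)
next
  fix j k :: nat and x :: "nat \<Rightarrow> real \<times> real" and y assume jk: "j < k" "k < n"
  then show "of_bool (live (vs (x(Suc k := y))) (ps (x(Suc k := y))) j) *
     (dual (mult (vs (x(Suc k := y))) (ps (x(Suc k := y))) j) -
      max 0 (er (fst ((x(Suc k := y)) (Suc j))) - mult (vs (x(Suc k := y))) (ps (x(Suc k := y))) j *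
        ec (fst ((x(Suc k := y)) (Suc j))))) =
     of_bool (live (vs x) (ps x) j) * (dual (mult (vs x) (ps x) j) -
      max 0 (er (fst (x (Suc j))) - mult (vs x) (ps x) j * ec (fst (x (Suc j)))))"
    by (simp add: state_upd fun_upd_other del: fun_upd_apply)
qed (use assms vbar_pos in auto)

section \<open>Rounds with bad estimates\<close>

lemma measurable_obs_sum:
  fixes h :: "real \<Rightarrow> real \<Rightarrow> real"
  assumes hm: "case_prod h \<in> borel_measurable (borel \<Otimes>\<^sub>M borel)" and "k < n"
  shows "(\<lambda>\<omega>. \<Sum>\<tau>\<in>obs (vs \<omega>) (ps \<omega>) k. h (fst (\<omega> (Suc k))) (snd (\<omega> \<tau>))) \<in> borel_measurable (P n)"
  unfolding sum_obs
proof (intro borel_measurable_sum)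
  fix j assume j: "j \<in> {..<k}"
  have [measurable]: "Measurable.pred (P n) (\<lambda>\<omega>. sel (vs \<omega>) (ps \<omega>) j)"
    using j assms by (intro measurable_state(1)) auto
  have [measurable]: "(\<lambda>\<omega>. h (fst (\<omega> (Suc k))) (snd (\<omega> (Suc j)))) \<in> borel_measurable (P n)"
    by (rule measurable_binary_compose[OF hm measurable_vs measurable_ps]) (use j assms in auto)
  show "(\<lambda>\<omega>. of_bool (sel (vs \<omega>) (ps \<omega>) j) * h (fst (\<omega> (Suc k))) (snd (\<omega> (Suc j)))) \<in> borel_measurable (P n)"
    by measurable
qed

lemma measurable_bad:
  assumes "k < n"
  shows "Measurable.pred (P n) (\<lambda>\<omega>. bad er ec (vs \<omega>) (ps \<omega>) k)"
proof -
  have 1: "case_prod rew \<in> borel_measurable (borel \<Otimes>\<^sub>M borel)"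
    "case_prod cost \<in> borel_measurable (borel \<Otimes>\<^sub>M borel)"
    unfolding case_prod_beta by measurable
  have c: "(\<lambda>\<omega>. real (card (obs (vs \<omega>) (ps \<omega>) k))) \<in> borel_measurable (P n)"
    using measurable_obs_sum[of "\<lambda>_ _. 1" k n] assms by simp
  have e: "(\<lambda>\<omega>. eps (vs \<omega>) (ps \<omega>) k) \<in> borel_measurable (P n)"
    unfolding eps_eq
    by (intro borel_measurable_divide borel_measurable_const measurable_compose[OF c borel_measurable_sqrt])
  have v: "(\<lambda>\<omega>. fst (\<omega> (Suc k))) \<in> borel_measurable (P n)"
    using assms by (intro measurable_vs) auto
  show ?thesis unfolding bad_def
    by (rule pred_abs_deviation[OF measurable_obs_sum[OF 1(1) assms] measurable_obs_sum[OF 1(2) assms] c e v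
       measurable_er measurable_ec])
qed

lemma bad_upd:
  assumes "Suc k < i"
  shows "bad er ec (vs (x(i := y))) (ps (x(i := y))) k = bad er ec (vs x) (ps x) k"
proof -
  have o: "obs (vs (x(i := y))) (ps (x(i := y))) k = obs (vs x) (ps x) k"
    using assms by (intro state_upd) simp
  have "(x(i := y)) \<tau> = x \<tau>" if "\<tau> \<in> obs (vs x) (ps x) k" for \<tau>
    using obs_subset[of "vs x" "ps x" k] that assms by auto
  moreover have "(x(i := y)) (Suc k) = x (Suc k)" using assms by simp
  ultimately show ?thesis
    unfolding bad_def o by (simp cong: sum.cong del: fun_upd_apply)
qed

text \<open>The quotients lie in \<open>[0,1]\<close> anyway when \<open>0 \<le> q\<close> and \<open>0 < w\<close>; the clipping
  only removes the null set of negative prices.\<close>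

definition unit_payoff :: "bool \<Rightarrow> real \<Rightarrow> real \<Rightarrow> real" where
  "unit_payoff b w q = max 0 (min 1 ((if b then rew w q else cost w q) / w))"

lemma measurable_unit_payoff: "case_prod (unit_payoff b) \<in> borel_measurable (borel \<Otimes>\<^sub>M borel)"
  unfolding unit_payoff_def case_prod_beta by (cases b) auto

lemma unit_payoff_bounds: "unit_payoff b w q \<in> {0..1}"
  by (auto simp: unit_payoff_def)

lemma unit_payoff_eq:
  assumes "0 < w" "0 \<le> q"
  shows "unit_payoff b w q = (if b then rew w q else cost w q) / w"
  using rew_bounds[of q w] cost_bounds[of q w] assms by (auto simp: unit_payoff_def)

definition unit_mean where "unit_mean b w = (\<integral>q. unit_payoff b w q \<partial>G)"

lemma unit_mean_eq:
  assumes "0 < w"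
  shows "unit_mean b w = (if b then er w else ec w) / w"
proof -
  have "unit_mean b w = (\<integral>q. (if b then rew w q else cost w q) / w \<partial>G)"
    unfolding unit_mean_def
  proof (rule integral_cong_AE)
    show "unit_payoff b w \<in> borel_measurable G"
      using measurable_binary_compose[OF measurable_unit_payoff, of "\<lambda>_. w" G "\<lambda>q. q" b] by simp
    show "(\<lambda>q. (if b then rew w q else cost w q) / w) \<in> borel_measurable G"
      by (cases b) auto
    show "AE q in G. unit_payoff b w q = (if b then rew w q else cost w q) / w"
      using AE_G by eventually_elim (use unit_payoff_eq[OF assms] in auto)
  qed
  then show ?thesis by (simp add: er_def ec_def)
qed

text \<open>The confidence width is \<open>radius / sqrt n\<close> for \<open>n\<close> samples, and
  the square of \<open>radius\<close> is at least \<open>ln T\<close>.\<close>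

definition radius where "radius = sqrt ((ln 2 + 2 * ln (real T)) / 2)"

definition tilt :: "real \<Rightarrow> nat \<Rightarrow> real" where "tilt c j = c * (8 * radius / (3 * 2 ^ j))"

text \<open>The value \<open>w\<close> is separate from \<open>\<omega>\<close>, so that it can be
  held fixed while the first \<open>k\<close> rounds are integrated.\<close>

definition tilt_exponent where
  "tilt_exponent b s w k \<omega> = (\<Sum>i<k. of_bool (sel (vs \<omega>) (ps \<omega>) i) *
      (s * (unit_payoff b w (snd (\<omega> (Suc i))) - unit_mean b w) - s\<^sup>2 * 1\<^sup>2 / 8))"

text \<open>One of the two estimates is off by more than its width. Multiplied by the sample size
  and divided by the value, this is a deviation of a sum of payoffs in the unit interval, to which
  \<open>dyadic_block_exponent\<close> applies.\<close>

lemma bad_imp_tilt_exponent: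
  assumes T: "1 \<le> T" and k: "1 \<le> k"
    and w: "fst (\<omega> (Suc k)) \<in> {0..vbar}" and q: "\<And>i. i \<in> {1..k} \<Longrightarrow> 0 \<le> snd (\<omega> i)"
    and bad: "bad er ec (vs \<omega>) (ps \<omega>) k"
  obtains b c j where "c = 1 \<or> c = -1" "4 ^ j \<le> k"
    "16 / 9 * radius\<^sup>2 \<le> tilt_exponent b (tilt c j) (fst (\<omega> (Suc k))) k \<omega>"
proof -
  let ?w = "fst (\<omega> (Suc k))" let ?n = "cnt (vs \<omega>) (ps \<omega>) k"
  let ?g = "\<lambda>b :: bool. if b then rew else cost" let ?m = "\<lambda>b :: bool. if b then er else ec"
  let ?S = "\<lambda>b. \<Sum>\<tau>\<in>obs (vs \<omega>) (ps \<omega>) k. ?g b ?w (snd (\<omega> \<tau>))"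
  have n: "1 \<le> ?n" using cnt_ge_1[OF k] .
  have r0: "0 \<le> radius" unfolding radius_def using T by simp
  have eps: "eps (vs \<omega>) (ps \<omega>) k = radius / sqrt ?n" by (simp add: eps_eq radius_def)
  have q': "0 \<le> snd (\<omega> \<tau>)" if "\<tau> \<in> obs (vs \<omega>) (ps \<omega>) k" for \<tau>
    using q obs_subset[of "vs \<omega>" "ps \<omega>" k] that by auto
  have dev: "\<exists>b. eps (vs \<omega>) (ps \<omega>) k * ?w < \<bar>?S b / ?n - ?m b ?w\<bar>"
    using bad unfolding bad_def by (auto simp: not_le intro: exI[of _ True] exI[of _ False])
  then obtain b where b: "eps (vs \<omega>) (ps \<omega>) k * ?w < \<bar>?S b / ?n - ?m b ?w\<bar>" ..
  \<comment> \<open>At value 0 both the estimates and the expectations vanish, so no round with that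
    value is bad.\<close>
  have w0: "0 < ?w"
  proof (rule ccontr)
    assume "\<not> 0 < ?w"
    then have z: "?w = 0" using w by simp
    have "?S b = 0"
    proof (rule sum.neutral, intro ballI)
      fix \<tau> assume "\<tau> \<in> obs (vs \<omega>) (ps \<omega>) k"
      then show "?g b ?w (snd (\<omega> \<tau>)) = 0"
        using q' rew_bounds[of "snd (\<omega> \<tau>)" 0] cost_bounds[of "snd (\<omega> \<tau>)" 0] z by auto
    qed
    moreover have "?m b ?w = 0" using er_bounds[of 0] ec_bounds[of 0] z by auto
    ultimately show False using b z by simp
  qed
  define D where "D = (\<Sum>i<k. of_bool (sel (vs \<omega>) (ps \<omega>) i) * (unit_payoff b ?w (snd (\<omega> (Suc i))) - unit_mean b ?w))"
  have "D = (\<Sum>\<tau>\<in>obs (vs \<omega>) (ps \<omega>) k. unit_payoff b ?w (snd (\<omega> \<tau>)) - unit_mean b ?w)"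
    unfolding D_def sum_obs ..
  also have "\<dots> = (\<Sum>\<tau>\<in>obs (vs \<omega>) (ps \<omega>) k. ?g b ?w (snd (\<omega> \<tau>)) / ?w - ?m b ?w / ?w)"
    by (rule sum.cong) (auto simp: unit_payoff_eq[OF w0 q'] unit_mean_eq[OF w0])
  also have "\<dots> = ?S b / ?w - ?n * (?m b ?w / ?w)"
    by (simp only: sum_subtractf sum_constant sum_divide_distrib)
  also have "\<dots> = ?n / ?w * (?S b / ?n - ?m b ?w)" using n w0 by (simp add: field_simps)
  finally have D: "\<bar>D\<bar> = ?n / ?w * \<bar>?S b / ?n - ?m b ?w\<bar>" using n w0 by (simp add: abs_mult)
  have "radius * sqrt ?n = radius * (?n / sqrt ?n)" by (simp add: real_div_sqrt)
  also have "\<dots> = ?n / ?w * (radius / sqrt ?n * ?w)" using w0 by simp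
  also have "\<dots> < \<bar>D\<bar>"
    unfolding D using b n w0 unfolding eps by (intro mult_strict_left_mono) auto
  finally have "radius * sqrt (real (card (obs (vs \<omega>) (ps \<omega>) k))) < \<bar>D\<bar>" .
  moreover have "1 \<le> card (obs (vs \<omega>) (ps \<omega>) k)" using n by simp
  ultimately obtain j c where jc: "4 ^ j \<le> card (obs (vs \<omega>) (ps \<omega>) k)" "c = 1 \<or> c = (-1::real)"
    "16 / 9 * radius\<^sup>2 \<le> c * (8 * radius / (3 * 2 ^ j)) * D - (8 * radius / (3 * 2 ^ j))\<^sup>2 / 8 * ?n"
    using dyadic_block_exponent[OF _ r0] by blast
  have t2: "(tilt c j)\<^sup>2 = (8 * radius / (3 * 2 ^ j))\<^sup>2" using jc(2) by (auto simp: tilt_def)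
  have "tilt_exponent b (tilt c j) ?w k \<omega> = tilt c j * D - (tilt c j)\<^sup>2 / 8 * ?n"
  proof -
    have "tilt_exponent b (tilt c j) ?w k \<omega> = (\<Sum>i<k. tilt c j *
        (of_bool (sel (vs \<omega>) (ps \<omega>) i) * (unit_payoff b ?w (snd (\<omega> (Suc i))) - unit_mean b ?w))
        - (tilt c j)\<^sup>2 / 8 * of_bool (sel (vs \<omega>) (ps \<omega>) i))"
      unfolding tilt_exponent_def by (rule sum.cong) auto
    then show ?thesis
      unfolding D_def cnt_eq by (simp only: sum_subtractf sum_distrib_left)
  qed
  also have "\<dots> = c * (8 * radius / (3 * 2 ^ j)) * D - (8 * radius / (3 * 2 ^ j))\<^sup>2 / 8 * ?n"
    unfolding t2 by (simp add: tilt_def)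
  finally have "16 / 9 * radius\<^sup>2 \<le> tilt_exponent b (tilt c j) ?w k \<omega>" using jc(3) by simp
  moreover have "4 ^ j \<le> k"
    using jc(1) card_mono[OF _ obs_subset[of "vs \<omega>" "ps \<omega>" k]] by simp
  ultimately show ?thesis using that jc(2) by blast
qed

text \<open>For fixed \<open>w\<close> the payoff ignores the value of its own round, so
  \<open>sel_mgf\<close> applies with range 1 and the increments form an exponential
  supermartingale.\<close>

lemma tilt_exponent_mgf:
  "(\<integral>\<^sup>+x. ennreal (exp (tilt_exponent b s w k x)) \<partial>P k) \<le> 1"
  unfolding tilt_exponent_def
proof (rule N.nn_integral_exp_sum_PiM_le_1)
  fix j m assume jm: "j < m" "m \<le> k"
  have [measurable]: "Measurable.pred (P m) (\<lambda>\<omega>. sel (vs \<omega>) (ps \<omega>) j)" by (rule measurable_state(1)[OF jm(1)])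
  have [measurable]: "(\<lambda>\<omega>. unit_payoff b w (snd (\<omega> (Suc j)))) \<in> borel_measurable (P m)"
    by (rule measurable_binary_compose[OF measurable_unit_payoff borel_measurable_const measurable_ps])
      (use jm in auto)
  show "(\<lambda>\<omega>. of_bool (sel (vs \<omega>) (ps \<omega>) j) *
      (s * (unit_payoff b w (snd (\<omega> (Suc j))) - unit_mean b w) - s\<^sup>2 * 1\<^sup>2 / 8)) \<in> borel_measurable (P m)"
    by measurable
next
  fix j m :: nat and x :: "nat \<Rightarrow> real \<times> real" and y assume jm: "j < m" "m < k"
  then show "of_bool (sel (vs (x(Suc m := y))) (ps (x(Suc m := y))) j) *
      (s * (unit_payoff b w (snd ((x(Suc m := y)) (Suc j))) - unit_mean b w) - s\<^sup>2 * 1\<^sup>2 / 8) =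
     of_bool (sel (vs x) (ps x) j) *
      (s * (unit_payoff b w (snd (x (Suc j))) - unit_mean b w) - s\<^sup>2 * 1\<^sup>2 / 8)"
    by (simp add: sel_upd fun_upd_other del: fun_upd_apply)
next
  fix m x assume "m < k" and x: "x \<in> space (P m)"
  have h: "case_prod (\<lambda>_. unit_payoff b w) \<in> borel_measurable (borel \<Otimes>\<^sub>M (borel :: real measure))"
    unfolding case_prod_beta
    by (rule measurable_binary_compose[OF measurable_unit_payoff]) auto
  show "(\<integral>\<^sup>+y. ennreal (exp (of_bool (sel (vs (x(Suc m := y))) (ps (x(Suc m := y))) m) *
      (s * (unit_payoff b w (snd ((x(Suc m := y)) (Suc m))) - unit_mean b w) - s\<^sup>2 * 1\<^sup>2 / 8))) \<partial>(F \<Otimes>\<^sub>M G)) \<le> 1"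
    using sel_mgf[OF x h, of 1 s] unit_payoff_bounds
    by (simp add: unit_mean_def fun_upd_same del: fun_upd_apply)
qed

lemma measurable_tilt_exponent:
  "(\<lambda>x. tilt_exponent b s (fst (x (Suc k))) k x) \<in> borel_measurable (P (Suc k))"
  unfolding tilt_exponent_def
proof (intro borel_measurable_sum)
  fix i assume i: "i \<in> {..<k}"
  have v: "(\<lambda>\<omega>. fst (\<omega> (Suc k))) \<in> borel_measurable (P (Suc k))" by (intro measurable_vs) auto
  have q: "(\<lambda>\<omega>. snd (\<omega> (Suc i))) \<in> borel_measurable (P (Suc k))" using i by (intro measurable_ps) auto
  have [measurable]: "Measurable.pred (P (Suc k)) (\<lambda>\<omega>. sel (vs \<omega>) (ps \<omega>) i)"
    using i by (intro measurable_state(1)) auto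
  have [measurable]: "(\<lambda>\<omega>. unit_payoff b (fst (\<omega> (Suc k))) (snd (\<omega> (Suc i)))) \<in> borel_measurable (P (Suc k))"
    by (rule measurable_binary_compose[OF measurable_unit_payoff v q])
  have [measurable]: "(\<lambda>\<omega>. unit_mean b (fst (\<omega> (Suc k)))) \<in> borel_measurable (P (Suc k))"
    unfolding unit_mean_def by (rule measurable_compose[OF v measurable_mean[OF measurable_unit_payoff]])
  show "(\<lambda>\<omega>. of_bool (sel (vs \<omega>) (ps \<omega>) i) * (s * (unit_payoff b (fst (\<omega> (Suc k))) (snd (\<omega> (Suc i)))
    - unit_mean b (fst (\<omega> (Suc k)))) - s\<^sup>2 * 1\<^sup>2 / 8)) \<in> borel_measurable (P (Suc k))"
    by measurable
qed

text \<open>The value of round \<open>Suc k\<close> is independent of the first \<open>k\<close>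
  rounds. With that coordinate integrated outermost, the bound for fixed \<open>w\<close> holds
  inside.\<close>

lemma tilt_exponent_mgf_random:
  "(\<integral>\<^sup>+x. ennreal (exp (tilt_exponent b s (fst (x (Suc k))) k x)) \<partial>P (Suc k)) \<le> 1"
proof -
  interpret Q: product_prob_space "\<lambda>_::nat. F \<Otimes>\<^sub>M G" by unfold_locales
  have ins: "{1..Suc k} = insert (Suc k) {1..k}" by auto
  have "(\<integral>\<^sup>+x. ennreal (exp (tilt_exponent b s (fst (x (Suc k))) k x)) \<partial>P (Suc k)) =
    (\<integral>\<^sup>+y. \<integral>\<^sup>+x. ennreal (exp (tilt_exponent b s (fst ((x(Suc k := y)) (Suc k))) k (x(Suc k := y)))) \<partial>P k \<partial>(F \<Otimes>\<^sub>M G))"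
  proof (unfold ins, rule Q.product_nn_integral_insert_rev)
    show "(\<lambda>x. ennreal (exp (tilt_exponent b s (fst (x (Suc k))) k x))) \<in>
      borel_measurable (PiM (insert (Suc k) {1..k}) (\<lambda>_. F \<Otimes>\<^sub>M G))"
      by (rule measurable_compose[OF measurable_tilt_exponent[of b s k, unfolded ins]]) simp
  qed auto
  also have "\<dots> = (\<integral>\<^sup>+y. \<integral>\<^sup>+x. ennreal (exp (tilt_exponent b s (fst y) k x)) \<partial>P k \<partial>(F \<Otimes>\<^sub>M G))"
    by (simp add: tilt_exponent_def sel_upd fun_upd_other fun_upd_same del: fun_upd_apply)
  also have "\<dots> \<le> (\<integral>\<^sup>+y. 1 \<partial>(F \<Otimes>\<^sub>M G))"
    by (intro nn_integral_mono tilt_exponent_mgf)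
  also have "\<dots> = 1" using N.emeasure_space_1 by simp
  finally show ?thesis .
qed

lemma AE_range: "AE \<omega> in P n. \<forall>t\<in>{1..n}. fst (\<omega> t) \<in> {0..vbar} \<and> snd (\<omega> t) \<in> {0..vbar}"
proof (rule AE_finite_allI[OF finite_atLeastAtMost])
  fix t assume "t \<in> {1..n}"
  then show "AE \<omega> in P n. fst (\<omega> t) \<in> {0..vbar} \<and> snd (\<omega> t) \<in> {0..vbar}"
    by (intro AE_PiM_component[OF N.prob_space_axioms _ AE_pair_range]) auto
qed

lemma bad_prob:
  assumes k: "1 \<le> k" "k < T"
  shows "(\<integral>\<^sup>+\<omega>. of_bool (bad er ec (vs \<omega>) (ps \<omega>) k) \<partial>P T) \<le> ennreal (4 * (ln (real T) + 1) * exp (- (16 / 9) * ln (real T)))"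
proof -
  have T: "1 \<le> T" using k by simp
  have lnT: "0 \<le> ln (real T)" using T by simp
  define J where "J = nat \<lfloor>ln (real T)\<rfloor>"
  define E where "E = ennreal (exp (- (16 / 9) * ln (real T)))"
  define A where "A = (UNIV :: bool set) \<times> ({1, -1} :: real set) \<times> {..J}"
  have rad: "ln (real T) \<le> radius\<^sup>2"
    unfolding radius_def using lnT by simp
  \<comment> \<open>Only about \<open>ln T\<close> blocks can occur, since \<open>ln 4\<close> is at
    least 1.\<close>
  have J: "j \<le> J" if "4 ^ j \<le> k" for j :: nat
  proof -
    have "real j * 1 \<le> real j * ln 4"
      using exp_le by (intro mult_left_mono) (auto simp: ln_ge_iff)
    also have "\<dots> = ln (real (4 ^ j))" by (simp add: ln_realpow)
    also have "\<dots> \<le> ln (real T)"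
    proof (intro ln_mono of_nat_mono)
      show "4 ^ j \<le> T" using that k by linarith
    qed auto
    finally show ?thesis unfolding J_def by (simp add: le_nat_floor)
  qed
  have m: "(\<lambda>\<omega>. of_bool (bad er ec (vs \<omega>) (ps \<omega>) k) :: ennreal) \<in> borel_measurable (P n)" if "Suc k \<le> n" for n
    using measurable_bad[of k n] that by simp
  have "(\<integral>\<^sup>+\<omega>. of_bool (bad er ec (vs \<omega>) (ps \<omega>) k) \<partial>P T) = (\<integral>\<^sup>+\<omega>. of_bool (bad er ec (vs \<omega>) (ps \<omega>) k) \<partial>P (Suc k))"
    by (rule N.nn_integral_PiM_initial_segment) (use k m in \<open>auto simp: bad_upd simp del: fun_upd_apply\<close>)
  \<comment> \<open>A union bound at the level of exponentials: in a bad round some summand is at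
    least 1. The set \<open>A\<close> ranges over the payoff, the sign and the block.\<close>
  also have "\<dots> \<le> (\<integral>\<^sup>+\<omega>. (\<Sum>(b, c, j)\<in>A. E * ennreal (exp (tilt_exponent b (tilt c j) (fst (\<omega> (Suc k))) k \<omega>))) \<partial>P (Suc k))"
  proof (rule nn_integral_mono_AE, use AE_range[of "Suc k"] in eventually_elim)
    fix \<omega> :: "nat \<Rightarrow> real \<times> real"
    assume rng: "\<forall>t\<in>{1..Suc k}. fst (\<omega> t) \<in> {0..vbar} \<and> snd (\<omega> t) \<in> {0..vbar}"
    let ?t = "\<lambda>b c j. E * ennreal (exp (tilt_exponent b (tilt c j) (fst (\<omega> (Suc k))) k \<omega>))"
    show "of_bool (bad er ec (vs \<omega>) (ps \<omega>) k) \<le> (\<Sum>(b, c, j)\<in>A. ?t b c j)"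
    proof (cases "bad er ec (vs \<omega>) (ps \<omega>) k")
      case True
      obtain b c j where bcj: "c = 1 \<or> c = -1" "4 ^ j \<le> k"
        "16 / 9 * radius\<^sup>2 \<le> tilt_exponent b (tilt c j) (fst (\<omega> (Suc k))) k \<omega>"
        by (rule bad_imp_tilt_exponent[OF T k(1) _ _ True]) (use rng in auto)
      have inA: "(b, c, j) \<in> A" using bcj J by (auto simp: A_def)
      have "1 \<le> ?t b c j"
        unfolding E_def using bcj(3) rad by (simp flip: ennreal_mult exp_add)
      also have "\<dots> = (case (b, c, j) of (b, c, j) \<Rightarrow> ?t b c j)" by simp
      also have "\<dots> \<le> (\<Sum>(b, c, j)\<in>A. ?t b c j)"
        by (rule member_le_sum[OF inA]) (auto simp: A_def)
      finally show ?thesis using True by simp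
    qed simp
  qed
  also have "\<dots> = (\<Sum>(b, c, j)\<in>A. \<integral>\<^sup>+\<omega>. E * ennreal (exp (tilt_exponent b (tilt c j) (fst (\<omega> (Suc k))) k \<omega>)) \<partial>P (Suc k))"
    unfolding case_prod_beta
    by (rule nn_integral_sum)
      (intro borel_measurable_times_ennreal borel_measurable_const measurable_compose[OF measurable_tilt_exponent],
        simp)
  also have "\<dots> \<le> (\<Sum>(b, c, j)\<in>A. E)"
  proof (rule sum_mono, clarify)
    fix b c j
    have "(\<integral>\<^sup>+\<omega>. E * ennreal (exp (tilt_exponent b (tilt c j) (fst (\<omega> (Suc k))) k \<omega>)) \<partial>P (Suc k)) =
      E * (\<integral>\<^sup>+\<omega>. ennreal (exp (tilt_exponent b (tilt c j) (fst (\<omega> (Suc k))) k \<omega>)) \<partial>P (Suc k))"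
      by (rule nn_integral_cmult) (rule measurable_compose[OF measurable_tilt_exponent], simp)
    also have "\<dots> \<le> E * 1" by (intro mult_left_mono tilt_exponent_mgf_random) auto
    finally show "(\<integral>\<^sup>+\<omega>. E * ennreal (exp (tilt_exponent b (tilt c j) (fst (\<omega> (Suc k))) k \<omega>)) \<partial>P (Suc k)) \<le> E"
      by simp
  qed
  also have "\<dots> = of_nat (card A) * E" by (simp add: case_prod_beta)
  also have "card A = 4 * (J + 1)" by (simp add: A_def card_cartesian_product)
  also have "of_nat (4 * (J + 1)) * E = ennreal (real (4 * (J + 1)) * exp (- (16 / 9) * ln (real T)))"
    unfolding E_def by (simp only: ennreal_mult ennreal_of_nat_eq_real_of_nat exp_ge_zero of_nat_0_le_iff)
  also have "\<dots> \<le> ennreal (4 * (ln (real T) + 1) * exp (- (16 / 9) * ln (real T)))"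
  proof (intro ennreal_leI mult_right_mono)
    have "real J \<le> ln (real T)" unfolding J_def using lnT by linarith
    then show "real (4 * (J + 1)) \<le> 4 * (ln (real T) + 1)" by simp
  qed simp
  finally show ?thesis .
qed

lemma measurable_bad_count [measurable]:
  "(\<lambda>\<omega>. \<Sum>k\<in>{1..<n}. of_bool (bad er ec (vs \<omega>) (ps \<omega>) k) :: real) \<in> borel_measurable (P n)"
proof (rule borel_measurable_sum)
  fix k assume "k \<in> {1..<n}"
  then have "Measurable.pred (P n) (\<lambda>\<omega>. bad er ec (vs \<omega>) (ps \<omega>) k)" by (intro measurable_bad) auto
  then show "(\<lambda>\<omega>. of_bool (bad er ec (vs \<omega>) (ps \<omega>) k) :: real) \<in> borel_measurable (P n)" by measurable
qed

lemma few_bad_rounds: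
  assumes T: "1 \<le> T"
  shows "measure (P T) {\<omega> \<in> space (P T). 15 * sqrt (real T) < (\<Sum>k\<in>{1..<T}. of_bool (bad er ec (vs \<omega>) (ps \<omega>) k))}
    \<le> 1 / real T"
proof -
  let ?B = "{\<omega> \<in> space (P T). 15 * sqrt (real T) < (\<Sum>k\<in>{1..<T}. of_bool (bad er ec (vs \<omega>) (ps \<omega>) k))}"
  define l where "l = ln (real T)"
  have l0: "0 \<le> l" using T by (simp add: l_def)
  have eT: "real T = exp l" using T by (simp add: l_def)
  have sT: "sqrt (real T) = exp (l / 2)" unfolding eT by (simp add: real_sqrt_unique exp_of_nat_mult[symmetric] flip: exp_double)
  have bm [measurable]: "Measurable.pred (P T) (\<lambda>\<omega>. bad er ec (vs \<omega>) (ps \<omega>) k)" if "k \<in> {1..<T}" for k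
    using that by (intro measurable_bad) auto
  have Bm: "?B \<in> sets (P T)" using measurable_bad_count by measurable
  have "ennreal (15 * sqrt (real T)) * emeasure (P T) ?B = (\<integral>\<^sup>+\<omega>. ennreal (15 * sqrt (real T)) * indicator ?B \<omega> \<partial>P T)"
    by (rule nn_integral_cmult_indicator[OF Bm, symmetric])
  also have "\<dots> \<le> (\<integral>\<^sup>+\<omega>. (\<Sum>k\<in>{1..<T}. of_bool (bad er ec (vs \<omega>) (ps \<omega>) k)) \<partial>P T)"
  proof (rule nn_integral_mono)
    fix \<omega>
    have "(\<Sum>k\<in>{1..<T}. of_bool (bad er ec (vs \<omega>) (ps \<omega>) k) :: ennreal) =
       ennreal (\<Sum>k\<in>{1..<T}. of_bool (bad er ec (vs \<omega>) (ps \<omega>) k))"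
      by (simp add: ennreal_of_nat_eq_real_of_nat)
    then show "ennreal (15 * sqrt (real T)) * indicator ?B \<omega> \<le> (\<Sum>k\<in>{1..<T}. of_bool (bad er ec (vs \<omega>) (ps \<omega>) k))"
      by (auto simp: indicator_def intro!: ennreal_leI)
  qed
  also have "\<dots> = (\<Sum>k\<in>{1..<T}. \<integral>\<^sup>+\<omega>. of_bool (bad er ec (vs \<omega>) (ps \<omega>) k) \<partial>P T)"
    by (rule nn_integral_sum) (use bm in measurable)
  also have "\<dots> \<le> (\<Sum>k\<in>{1..<T}. ennreal (4 * (l + 1) * exp (- (16 / 9) * l)))"
    unfolding l_def by (intro sum_mono bad_prob) auto
  also have "\<dots> = ennreal (real (T - 1) * (4 * (l + 1) * exp (- (16 / 9) * l)))"
    using l0 by (simp add: ennreal_mult ennreal_of_nat_eq_real_of_nat)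
  also have "\<dots> \<le> ennreal (exp l * (4 * (l + 1) * exp (- (16 / 9) * l)))"
    using l0 unfolding eT[symmetric] by (intro ennreal_leI mult_right_mono) auto
  also have "\<dots> \<le> ennreal (15 * exp (- l / 2))"
  proof (rule ennreal_leI)
    \<comment> \<open>The slack \<open>16/9 - 1 - 1/2 = 5/18\<close> in the exponent absorbs the
      logarithmic factor, and 15 is large enough since \<open>15 * 5 / 18\<close> exceeds 4.\<close>
    have "4 * (l + 1) \<le> 15 * (1 + 5 / 18 * l)" using l0 by simp
    also have "\<dots> \<le> 15 * exp (5 / 18 * l)" by (intro mult_left_mono exp_ge_add_one_self) simp
    finally have "exp l * (4 * (l + 1) * exp (- (16 / 9) * l)) \<le> exp l * (15 * exp (5 / 18 * l) * exp (- (16 / 9) * l))"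
      by (intro mult_left_mono mult_right_mono) auto
    also have "\<dots> = 15 * (exp l * exp (5 / 18 * l) * exp (- (16 / 9) * l))" by (simp add: mult_ac)
    also have "exp l * exp (5 / 18 * l) * exp (- (16 / 9) * l) = exp (l + 5 / 18 * l + - (16 / 9) * l)"
      by (simp only: exp_add)
    also have "l + 5 / 18 * l + - (16 / 9) * l = - l / 2" by simp
    finally show "exp l * (4 * (l + 1) * exp (- (16 / 9) * l)) \<le> 15 * exp (- l / 2)" .
  qed
  finally have "ennreal (15 * exp (l / 2) * measure (P T) ?B) \<le> ennreal (15 * exp (- l / 2))"
    unfolding Pn.emeasure_eq_measure sT by (simp add: ennreal_mult)
  then have "15 * exp (l / 2) * measure (P T) ?B \<le> 15 * exp (- l / 2)"
    by (subst (asm) ennreal_le_iff) simp_all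
  then have "exp (l / 2) * (exp (l / 2) * measure (P T) ?B) \<le> exp (l / 2) * exp (- l / 2)"
    by (intro mult_left_mono) auto
  then have "exp (l / 2 + l / 2) * measure (P T) ?B \<le> exp (l / 2 + - l / 2)"
    by (simp only: exp_add mult.assoc)
  then show ?thesis unfolding eT by (simp add: field_simps)
qed

section \<open>Combination of the exceptional events\<close>

lemma regret_probability:
  assumes T: "1 \<le> T" and lnT: "1 \<le> ln (real T)"
  shows "1 - 4 / real T \<le> measure (P T) {\<omega> \<in> space (P T).
     OPT F G \<rho> T - rev (vs \<omega>) (ps \<omega>) T \<le> regret_const * sqrt (real T * ln (real T))}"
proof -
  define S where "S = sqrt (real T * ln (real T))"
  have S0: "0 \<le> S" using lnT by (simp add: S_def)
  obtain opt where opt: "OPT F G \<rho> T = real T * opt" "\<And>l. 0 \<le> l \<Longrightarrow> opt \<le> dual l + l * \<rho>" "opt \<le> vbar"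
    by (rule OPT_dual) (rule that; blast)
  let ?good = "{\<omega> \<in> space (P T). OPT F G \<rho> T - rev (vs \<omega>) (ps \<omega>) T \<le> regret_const * S}"
  define g where "g \<omega> k = of_bool (live (vs \<omega>) (ps \<omega>) k) * (dual (mult (vs \<omega>) (ps \<omega>) k) -
      max 0 (er (fst (\<omega> (Suc k))) - mult (vs \<omega>) (ps \<omega>) k * ec (fst (\<omega> (Suc k)))))" for \<omega> k
  define d where "d h c \<omega> k = c * (of_bool (sel (vs \<omega>) (ps \<omega>) k) *
     (h (fst (\<omega> (Suc k))) (snd (\<omega> (Suc k))) - (\<integral>q. h (fst (\<omega> (Suc k))) q \<partial>G)))"
    for h :: "real \<Rightarrow> real \<Rightarrow> real" and c :: real and \<omega> k
  define B1 where "B1 = {\<omega> \<in> space (P T). vbar * S < (\<Sum>k<T. g \<omega> k)}"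
  define B2 where "B2 = {\<omega> \<in> space (P T). vbar * S < (\<Sum>k<T. d rew (-1) \<omega> k)}"
  define B3 where "B3 = {\<omega> \<in> space (P T). vbar * S < (\<Sum>k<T. d cost 1 \<omega> k)}"
  define B4 where "B4 = {\<omega> \<in> space (P T). 15 * sqrt (real T) < (\<Sum>k\<in>{1..<T}. of_bool (bad er ec (vs \<omega>) (ps \<omega>) k))}"
  have payoff_m: "case_prod rew \<in> borel_measurable (borel \<Otimes>\<^sub>M borel)"
    "case_prod cost \<in> borel_measurable (borel \<Otimes>\<^sub>M borel)"
    unfolding case_prod_beta by measurable
  have AE_payoff: "AE q in G. rew w q \<in> {0..vbar}" "AE q in G. cost w q \<in> {0..vbar}" if "w \<in> {0..vbar}" for w
    using AE_rew[of w] AE_cost[of w] that by auto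
  \<comment> \<open>As \<open>S^2 = T * ln T\<close>, a deviation of \<open>vbar * S\<close> has
    probability at most \<open>1 / T^2\<close>.\<close>
  have "exp (- 2 * (vbar * S)\<^sup>2 / (real T * vbar\<^sup>2)) = exp (- 2 * ln (real T))"
    using vbar_pos lnT T by (simp add: S_def power_mult_distrib)
  also have "\<dots> \<le> exp (- ln (real T))" using lnT by simp
  also have "\<dots> = 1 / real T" using T by (simp add: exp_minus inverse_eq_divide)
  finally have tail: "exp (- 2 * (vbar * S)\<^sup>2 / (real T * vbar\<^sup>2)) \<le> 1 / real T" .
  have A0: "0 \<le> vbar * S" using S0 vbar_pos by simp
  have T0: "0 < T" using T by simp
  have p1: "measure (P T) B1 \<le> 1 / real T"
    using lagrangian_deviation[OF T0 A0] tail unfolding B1_def g_def by linarith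
  have p2: "measure (P T) B2 \<le> 1 / real T"
    using sel_deviation[OF payoff_m(1) AE_payoff(1) _ T0 A0, of "-1"] tail unfolding B2_def d_def by auto
  have p3: "measure (P T) B3 \<le> 1 / real T"
    using sel_deviation[OF payoff_m(2) AE_payoff(2) _ T0 A0, of 1] tail unfolding B3_def d_def by auto
  have p4: "measure (P T) B4 \<le> 1 / real T"
    using few_bad_rounds[OF T] unfolding B4_def .
  have [measurable]: "(\<lambda>\<omega>. \<Sum>k<T. g \<omega> k) \<in> borel_measurable (P T)"
    unfolding g_def by (intro borel_measurable_sum measurable_lagrangian_deviation) auto
  have [measurable]: "(\<lambda>\<omega>. \<Sum>k<T. d rew c \<omega> k) \<in> borel_measurable (P T)"
    "(\<lambda>\<omega>. \<Sum>k<T. d cost c \<omega> k) \<in> borel_measurable (P T)" for c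
    unfolding d_def by (intro borel_measurable_sum measurable_sel_deviation payoff_m; simp)+
  have Bm: "B1 \<in> sets (P T)" "B2 \<in> sets (P T)" "B3 \<in> sets (P T)" "B4 \<in> sets (P T)"
    unfolding B1_def B2_def B3_def B4_def by measurable
  have good_m: "?good \<in> sets (P T)" using measurable_rev[of T] by measurable
  \<comment> \<open>The path argument needs values and prices in range, which holds almost surely;
    hence an inclusion up to a null set.\<close>
  have "AE \<omega> in P T. \<omega> \<in> space (P T) - ?good \<longrightarrow> \<omega> \<in> B1 \<union> B2 \<union> B3 \<union> B4"
    using AE_range[of T]
  proof eventually_elim
    case (elim \<omega>)
    interpret path: ogd_path vbar \<rho> T "vs \<omega>" "ps \<omega>"
      by unfold_locales (use elim in auto)
    show ?case
    proof (intro impI, rule ccontr)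
      assume \<omega>: "\<omega> \<in> space (P T) - ?good" and nB: "\<omega> \<notin> B1 \<union> B2 \<union> B3 \<union> B4"
      have er: "er w \<in> {0..vbar}" "ec w \<in> {0..vbar}" if "w \<in> {0..vbar}" for w
        using er_bounds[of w] ec_bounds[of w] that by auto
      have "real T * opt - rev (vs \<omega>) (ps \<omega>) T \<le> regret_const * sqrt (real T * ln (real T))"
      proof (rule path.regret_bound[where r = er and c = ec and \<phi> = dual])
        show "(\<Sum>k<T. of_bool (live (vs \<omega>) (ps \<omega>) k) * (dual (mult (vs \<omega>) (ps \<omega>) k) -
            max 0 (er (fst (\<omega> (Suc k))) - mult (vs \<omega>) (ps \<omega>) k * ec (fst (\<omega> (Suc k)))))) \<le> vbar * sqrt (real T * ln (real T))"
          using nB \<omega> by (simp add: B1_def g_def S_def not_less)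
        show "(\<Sum>k<T. of_bool (sel (vs \<omega>) (ps \<omega>) k) * (er (fst (\<omega> (Suc k))) - rew (fst (\<omega> (Suc k))) (snd (\<omega> (Suc k))))) \<le> vbar * sqrt (real T * ln (real T))"
          using nB \<omega> by (simp add: B2_def d_def S_def er_def not_less algebra_simps)
        show "(\<Sum>k<T. of_bool (sel (vs \<omega>) (ps \<omega>) k) * (cost (fst (\<omega> (Suc k))) (snd (\<omega> (Suc k))) - ec (fst (\<omega> (Suc k))))) \<le> vbar * sqrt (real T * ln (real T))"
          using nB \<omega> by (simp add: B3_def d_def S_def ec_def not_less)
        show "(\<Sum>k\<in>{1..<T}. of_bool (bad er ec (vs \<omega>) (ps \<omega>) k)) \<le> 15 * sqrt (real T)"
          using nB \<omega> by (simp only: B4_def Un_iff mem_Collect_eq Diff_iff de_Morgan_disj not_less) simp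
      qed (use lnT opt er in auto)
      then show False using \<omega> opt(1) by (simp add: S_def)
    qed
  qed
  then have "measure (P T) (space (P T) - ?good) \<le> measure (P T) (B1 \<union> B2 \<union> B3 \<union> B4)"
    by (rule Pn.finite_measure_mono_AE) (use Bm in auto)
  also have "\<dots> \<le> measure (P T) (B1 \<union> B2 \<union> B3) + measure (P T) B4"
    by (rule measure_Un_le) (use Bm in auto)
  also have "measure (P T) (B1 \<union> B2 \<union> B3) \<le> measure (P T) (B1 \<union> B2) + measure (P T) B3"
    by (rule measure_Un_le) (use Bm in auto)
  also have "measure (P T) (B1 \<union> B2) \<le> measure (P T) B1 + measure (P T) B2"
    by (rule measure_Un_le) (use Bm in auto)
  finally have "measure (P T) (space (P T) - ?good) \<le> 4 / real T"
    using p1 p2 p3 p4 by simp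
  then show ?thesis
    using Pn.prob_compl[OF good_m] unfolding S_def by linarith
qed

end

theorem theorem6:
  fixes vbar \<rho> :: real
  assumes "0 < vbar" and "0 < \<rho>" and "\<rho> \<le> vbar"
  shows "\<exists>C::real. \<forall>(T::nat) F G. T \<ge> 1 \<longrightarrow> dist_on vbar F \<longrightarrow> dist_on vbar G \<longrightarrow>
     measure (PiM {1..T} (\<lambda>_. F \<Otimes>\<^sub>M G))
       {\<omega> \<in> space (PiM {1..T} (\<lambda>_. F \<Otimes>\<^sub>M G)).
          OPT F G \<rho> T - ogd_revenue vbar \<rho> T (\<lambda>t. fst (\<omega> t)) (\<lambda>t. snd (\<omega> t))
            \<le> C * sqrt (real T * ln (real T))}
     \<ge> 1 - 4 / real T"
proof (intro exI allI impI)
  fix T :: nat and F G assume T: "1 \<le> T" and FG: "dist_on vbar F" "dist_on vbar G"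
  interpret ogd_stoch vbar \<rho> T F G by unfold_locales (fact assms FG)+
  show "1 - 4 / real T \<le> measure (PiM {1..T} (\<lambda>_. F \<Otimes>\<^sub>M G))
       {\<omega> \<in> space (PiM {1..T} (\<lambda>_. F \<Otimes>\<^sub>M G)).
          OPT F G \<rho> T - ogd_revenue vbar \<rho> T (\<lambda>t. fst (\<omega> t)) (\<lambda>t. snd (\<omega> t))
            \<le> ogd.regret_const vbar \<rho> * sqrt (real T * ln (real T))}"
  \<comment> \<open>Up to 4 rounds the probability bound is nonpositive. Beyond that
    \<open>T\<close> exceeds 3 and so \<open>exp 1\<close>, which gives
    \<open>1 <= ln T\<close>.\<close>
  proof (cases "T \<le> 4")
    case True
    then have "1 - 4 / real T \<le> 0" using T by (simp add: field_simps)
    then show ?thesis using measure_nonneg order_trans by blast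
  next
    case False
    then have "exp 1 \<le> real T" using exp_le by linarith
    then have "1 \<le> ln (real T)" using T by (simp add: ln_ge_iff)
    then show ?thesis using regret_probability[OF T] by (simp only: rev_def ogd_revenue_def)
  qed
qed

end
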